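(* Let $\mathcal{P}$ be an arbitrary finite polysquare surface. A half-infinite geodesic on $\mathcal{P}$ that does not hit a vertex of $\mathcal{P}$ is superdense on $\mathcal{P}$ if and only if the slope of the geodesic is a badly approximable number.
   Context: A finite polysquare region is an arbitrary connected, but not necessarily simply-connected, polygon $P$ in the plane tiled with finitely many closed unit squares (with horizontal and vertical sides), called the atomic squares of $P$, such that: (i) any two atomic squares in $P$ either are disjoint, or intersect at a single point, or have a common edge; (ii) any two atomic squares in $P$ are joined by a chain of atomic squares where any two neighbors in the chain have a common edge. $P$ may have holes, and may have whole barriers, i.e. horizontal or vertical walls consisting of one or more boundary edges of atomic squares (the two sides of a wall count as boundary edges). A finite polysquare surface $\mathcal{P}$ (square tiled surface) is obtained from a finite polysquare region by pairwise identification (by translation) of the boundary horizontal edges and pairwise identification (by translation) of the boundary vertical edges, so that each top edge of an atomic square is identified with a unique bottom edge of an atomic square, each right edge with a unique left edge, and geodesic flow on $\mathcal{P}$ is $1$-direction linear flow. The vertices of $\mathcal{P}$ are the points coming from the corners of the atomic squares. $\mathcal{P}$ carries the flat metric of the squares. A half-infinite geodesic $\mathcal{L}(t)$, $t\ge0$, is a straight unit-speed path in a fixed direction on $\mathcal{P}$, with arc-length parametrization; its slope is the slope of this direction. A half-infinite geodesic $\mathcal{L}(t)$, $t\ge0$, is superdense on $\mathcal{P}$ if there exists a constant $C_1=C_1(\mathcal{P};\mathcal{L})>0$ such that, for every integer $n\ge1$, the initial segment $\mathcal{L}(t)$, $0\le t\le C_1n$, gets $(1/n)$-close to every point of $\mathcal{P}$.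 An irrational number $\alpha$ with continued fraction $\alpha=[a_0;a_1,a_2,a_3,\ldots]$ is badly approximable if there exists a constant $A$ such that $a_i\le A$ for every $i=0,1,2,3,\ldots$. *)

theory Defs
  imports "HOL-Analysis.Analysis"
begin

text \<open>An atomic square is named by its lower left corner.\<close>

definition atomic :: "real \<times> real \<Rightarrow> (real \<times> real) set" where
  "atomic s = cbox s (s + (1, 1))"

definition bottom_edge :: "real \<times> real \<Rightarrow> (real \<times> real) set" where
  "bottom_edge s = closed_segment s (s + (1, 0))"

definition top_edge :: "real \<times> real \<Rightarrow> (real \<times> real) set" where
  "top_edge s = closed_segment (s + (0, 1)) (s + (1, 1))"

definition left_edge :: "real \<times> real \<Rightarrow> (real \<times> real) set" where
  "left_edge s = closed_segment s (s + (0, 1))"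

definition right_edge :: "real \<times> real \<Rightarrow> (real \<times> real) set" where
  "right_edge s = closed_segment (s + (1, 0)) (s + (1, 1))"

definition edges :: "real \<times> real \<Rightarrow> (real \<times> real) set set" where
  "edges s = {bottom_edge s, top_edge s, left_edge s, right_edge s}"

definition corners :: "real \<times> real \<Rightarrow> (real \<times> real) set" where
  "corners s = {s, s + (1, 0), s + (0, 1), s + (1, 1)}"

text \<open>The set \<open>walls\<close> consists of the edges that form the barriers. The two sides of a wall
  are boundary edges, so two squares separated by a wall are not neighbours.\<close>

record region =
  squares :: "(real \<times> real) set"
  walls :: "(real \<times> real) set set"

definition neighbours :: "'a region_scheme \<Rightarrow> ((real \<times> real) \<times> (real \<times> real)) set" where
  "neighbours P = {(s, q). s \<in> squares P \<and> q \<in> squares P \<and> s \<noteq> q \<and>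
     (\<exists>e \<in> edges s \<inter> edges q. e \<notin> walls P)}"

definition polysquare_region :: "'a region_scheme \<Rightarrow> bool" where
  "polysquare_region P \<longleftrightarrow>
     finite (squares P) \<and> squares P \<noteq> {} \<and>
     walls P \<subseteq> (\<Union>s\<in>squares P. edges s) \<and>
     (\<forall>s\<in>squares P. \<forall>q\<in>squares P. s \<noteq> q \<longrightarrow>
        atomic s \<inter> atomic q = {} \<or>
        (\<exists>x. atomic s \<inter> atomic q = {x}) \<or>
        atomic s \<inter> atomic q \<in> edges s \<inter> edges q) \<and>
     (\<forall>s\<in>squares P. \<forall>q\<in>squares P. (s, q) \<in> (neighbours P)\<^sup>*)"

text \<open>The right edge of \<open>s\<close> is identified with the left edge of \<open>right_nb s\<close>, and the top edge
  of \<open>s\<close> with the bottom edge of \<open>top_nb s\<close>. An edge common to two squares that is not a wall is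
  identified with itself; by bijectivity the boundary edges are then paired among themselves.\<close>

record surface = region +
  right_nb :: "real \<times> real \<Rightarrow> real \<times> real"
  top_nb :: "real \<times> real \<Rightarrow> real \<times> real"

definition polysquare_surface :: "surface \<Rightarrow> bool" where
  "polysquare_surface P \<longleftrightarrow>
     polysquare_region P \<and>
     bij_betw (right_nb P) (squares P) (squares P) \<and>
     bij_betw (top_nb P) (squares P) (squares P) \<and>
     (\<forall>s\<in>squares P. \<forall>q\<in>squares P.
        right_edge s = left_edge q \<and> right_edge s \<notin> walls P \<longrightarrow> right_nb P s = q) \<and>
     (\<forall>s\<in>squares P. \<forall>q\<in>squares P.
        top_edge s = bottom_edge q \<and> top_edge s \<notin> walls P \<longrightarrow> top_nb P s = q)"

text \<open>The surface is the quotient of the disjoint union of the closed atomic squares; a pair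
  \<open>(s, z)\<close> is the point \<open>z\<close> of the plane seen as a point of the square \<open>s\<close>.\<close>

type_synonym point = "(real \<times> real) \<times> (real \<times> real)"

definition square_points :: "surface \<Rightarrow> point set" where
  "square_points P = (SIGMA s:squares P. atomic s)"

definition edge_glue :: "surface \<Rightarrow> (point \<times> point) set" where
  "edge_glue P =
     {((s, z), (right_nb P s, z + (right_nb P s - (s + (1, 0))))) | s z.
        s \<in> squares P \<and> z \<in> right_edge s} \<union>
     {((s, z), (top_nb P s, z + (top_nb P s - (s + (0, 1))))) | s z.
        s \<in> squares P \<and> z \<in> top_edge s}"

definition glue :: "surface \<Rightarrow> (point \<times> point) set" where
  "glue P = (edge_glue P \<union> (edge_glue P)\<inverse>)\<^sup>* \<inter> (square_points P \<times> square_points P)"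

definition surface_points :: "surface \<Rightarrow> point set set" where
  "surface_points P = square_points P // glue P"

definition surface_point :: "surface \<Rightarrow> point \<Rightarrow> point set" where
  "surface_point P p = glue P `` {p}"

definition vertices :: "surface \<Rightarrow> point set set" where
  "vertices P = {surface_point P (s, c) | s c. s \<in> squares P \<and> c \<in> corners s}"

text \<open>The flat metric is the quotient length metric: the infimum of the lengths of the broken
  lines whose pieces are segments in the closed squares. \<open>broken_line P p q l\<close> means that
  such a line of length \<open>l\<close> leads from \<open>p\<close> to \<open>q\<close>.\<close>

inductive broken_line :: "surface \<Rightarrow> point \<Rightarrow> point \<Rightarrow> real \<Rightarrow> bool" for P where
  segment: "\<lbrakk>s \<in> squares P; z \<in> atomic s; w \<in> atomic s\<rbrakk>
      \<Longrightarrow> broken_line P (s, z) (s, w) (dist z w)"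
| cross: "(p, q) \<in> glue P \<Longrightarrow> broken_line P p q 0"
| join: "\<lbrakk>broken_line P p q k; broken_line P q r l\<rbrakk> \<Longrightarrow> broken_line P p r (k + l)"

definition flat_dist :: "surface \<Rightarrow> point set \<Rightarrow> point set \<Rightarrow> real" where
  "flat_dist P X Y = Inf {l. \<exists>p\<in>X. \<exists>q\<in>Y. broken_line P p q l}"

definition straight_on :: "surface \<Rightarrow> real \<times> real \<Rightarrow> (real \<Rightarrow> point set) \<Rightarrow> real set \<Rightarrow> bool" where
  "straight_on P v L I \<longleftrightarrow>
     (\<exists>s\<in>squares P. \<exists>z. \<forall>t\<in>I. z + t *\<^sub>R v \<in> atomic s \<and> L t = surface_point P (s, z + t *\<^sub>R v))"

text \<open>Near each time the path runs in direction \<open>v\<close> inside one closed square before and inside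
  one closed square after. Away from vertices this makes it straight, also where it crosses an
  edge, since the gluing is by translations. At a vertex of cone angle greater than \<open>2 * pi\<close>
  the continuation is not unique, so the notion is meant for paths avoiding the vertices. Values
  of \<open>L\<close> at negative times are irrelevant.\<close>

definition half_geodesic :: "surface \<Rightarrow> real \<times> real \<Rightarrow> (real \<Rightarrow> point set) \<Rightarrow> bool" where
  "half_geodesic P v L \<longleftrightarrow>
     norm v = 1 \<and>
     (\<forall>t\<ge>0. \<exists>b>t. straight_on P v L {t..b}) \<and>
     (\<forall>t>0. \<exists>a\<ge>0. a < t \<and> straight_on P v L {a..t})"

definition superdense :: "surface \<Rightarrow> (real \<Rightarrow> point set) \<Rightarrow> bool" where
  "superdense P L \<longleftrightarrow>
     (\<exists>C>0. \<forall>n::nat. n \<ge> 1 \<longrightarrow>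
        (\<forall>X\<in>surface_points P. \<exists>t. 0 \<le> t \<and> t \<le> C * real n \<and> flat_dist P (L t) X \<le> 1 / real n))"

fun complete_quotient :: "real \<Rightarrow> nat \<Rightarrow> real" where
  "complete_quotient \<alpha> 0 = \<alpha>"
| "complete_quotient \<alpha> (Suc i) = 1 / frac (complete_quotient \<alpha> i)"

definition partial_quotient :: "real \<Rightarrow> nat \<Rightarrow> int" where
  "partial_quotient \<alpha> i = \<lfloor>complete_quotient \<alpha> i\<rfloor>"

definition badly_approximable :: "real \<Rightarrow> bool" where
  "badly_approximable \<alpha> \<longleftrightarrow> \<alpha> \<notin> \<rat> \<and> (\<exists>A. \<forall>i. partial_quotient \<alpha> i \<le> A)"

end

theory Submission
  imports Defs
begin

text \<open>Let \<open>v = (a, b)\<close> be the direction. Both conditions are compared with the diophantine condition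
  that \<open>\<bar>m a + k b\<bar> (\<bar>m\<bar> + \<bar>k\<bar>)\<close> is bounded below over all integer vectors \<open>(m, k) \<noteq> 0\<close>.

  If the geodesic is superdense, then so is its image on the unit torus, where \<open>m x + k y\<close> is well
  defined modulo 1 and has speed \<open>m a + k b\<close>; a small value of the product would freeze this
  function for too long.

  Conversely, project an atomic square along \<open>v\<close>: the crossings of a geodesic with edges become an
  orbit of a skew product over an exchange of two intervals of lengths \<open>\<bar>b\<bar>\<close> and \<open>\<bar>a\<bar>\<close>, whose
  fibre permutations are the two gluings. Inducing this map as in the Euclidean algorithm keeps
  its form. Bounded type keeps the two lengths comparable at every stage, so a tower over a stage of
  width about \<open>1 / n\<close> has height \<open>O(n)\<close>. The sets of fibres visited by the
  towers can stagnate only when they are everything, because the two permutations act transitively;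
  hence every orbit of a stage passes through all towers in a bounded number of steps.\<close>


section \<open>Badly approximable numbers\<close>


text \<open>Density of the projection of an orbit to the interval could be read off from the lengths
  alone. The obstacle is the fibre: an orbit might avoid some squares for a long time, and the fibre
  permutations change at every stage, with nothing known about them but transitivity. So a delay is
  required that does not depend on the stage. It comes from counting: the number of pairs (square,
  letter) met by a tower, summed over all towers, never decreases, is at most 4 |S|^2, and grows in
  every window of 2 K + 3 stages that does not end with full towers, where K bounds the ratio of the
  two lengths. As each stage is again an exchange of the same kind with the same S and K, the
  resulting bound can be applied at the stage matched to 1 / n.

  The ratio bound comes from the shift of a return: it is an integer combination of the two lengths
  whose coefficients add up to the height of the tower, so the diophantine condition bounds it below
  in terms of this height. For continued fractions, a quadratic form whose value is invariant under
  the algorithm replaces estimates for convergents.\<close>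

definition bad_form :: "real \<Rightarrow> bool" where
  "bad_form \<alpha> \<longleftrightarrow> (\<exists>c>0. \<forall>m k :: int. (m, k) \<noteq> (0, 0) \<longrightarrow>
     c \<le> \<bar>real_of_int m * \<alpha> - real_of_int k\<bar> * (\<bar>real_of_int m\<bar> + \<bar>real_of_int k\<bar>))"

lemma bad_form_irrational:
  assumes "bad_form \<alpha>"
  shows "\<alpha> \<notin> \<rat>"
proof
  assume "\<alpha> \<in> \<rat>"
  then obtain k m :: int where "m \<noteq> 0" "\<alpha> = of_int k / of_int m"
    by (metis Rats_cases' less_irrefl)
  then have "real_of_int m * \<alpha> - real_of_int k = 0"
    by simp
  moreover obtain c where "c > 0" and c: "\<And>m k :: int. (m, k) \<noteq> (0, 0) \<Longrightarrow>
     c \<le> \<bar>real_of_int m * \<alpha> - real_of_int k\<bar> * (\<bar>real_of_int m\<bar> + \<bar>real_of_int k\<bar>)"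
    using assms unfolding bad_form_def by blast
  ultimately show False
    using c[of m k] \<open>m \<noteq> 0\<close> by simp
qed

section \<open>Complete quotients, their conjugates and the invariant form\<close>

declare complete_quotient.simps(2) [simp del]

lemma frac_irrational_pos: "x \<notin> \<rat> \<Longrightarrow> 0 < frac (x :: real)"
  by (metis Ints_subset_Rats frac_gt_0_iff subsetD)

lemma complete_quotient_irrational:
  assumes "\<alpha> \<notin> \<rat>"
  shows "complete_quotient \<alpha> i \<notin> \<rat>"
proof (induction i)
  case 0
  then show ?case using assms by simp
next
  case (Suc i)
  have "frac (complete_quotient \<alpha> i) \<in> \<rat>" if "1 / frac (complete_quotient \<alpha> i) \<in> \<rat>"
    using Rats_inverse[OF that] by (simp add: inverse_eq_divide)
  then have "1 / frac (complete_quotient \<alpha> i) \<notin> \<rat>"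
    using Suc unfolding frac_def
    by (metis Rats_add Rats_of_int diff_add_cancel)
  then show ?case by (simp add: complete_quotient.simps(2))
qed

lemma complete_quotient_Suc_gt_1:
  "\<alpha> \<notin> \<rat> \<Longrightarrow> 1 < complete_quotient \<alpha> (Suc i)"
  using frac_irrational_pos[OF complete_quotient_irrational, of \<alpha> i] frac_lt_1[of "complete_quotient \<alpha> i"]
  by (simp add: complete_quotient.simps(2))

lemma complete_quotient_eq:
  "complete_quotient \<alpha> i = of_int (partial_quotient \<alpha> i) + 1 / complete_quotient \<alpha> (Suc i)"
  by (simp add: partial_quotient_def frac_def complete_quotient.simps(2))

lemma partial_quotient_ge_1: "\<alpha> \<notin> \<rat> \<Longrightarrow> 1 \<le> partial_quotient \<alpha> (Suc i)"
  unfolding partial_quotient_def using complete_quotient_Suc_gt_1[of \<alpha> i] by linarith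

text \<open>A formal conjugate of \<open>\<alpha>\<close>: it makes \<open>m x - k\<close> the factor of an indefinite binary
  quadratic form whose value, normalised by its discriminant, is invariant under the
  continued fraction algorithm.\<close>

fun conj_quotient :: "real \<Rightarrow> nat \<Rightarrow> real" where
  "conj_quotient \<alpha> 0 = of_int (partial_quotient \<alpha> 0) - 2"
| "conj_quotient \<alpha> (Suc i) = 1 / (conj_quotient \<alpha> i - of_int (partial_quotient \<alpha> i))"

definition form :: "real \<Rightarrow> nat \<Rightarrow> int \<Rightarrow> int \<Rightarrow> real" where
  "form \<alpha> i m k = \<bar>of_int m * complete_quotient \<alpha> i - of_int k\<bar> * \<bar>of_int m * conj_quotient \<alpha> i - of_int k\<bar>
     / (complete_quotient \<alpha> i - conj_quotient \<alpha> i)"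

declare conj_quotient.simps(2) [simp del]

text \<open>Starting two below the integer part makes the first conjugate exactly -1/2, and x -> 1 /
  (x - a) with a >= 1 maps (-1, 0) into itself. From index 1 on the pair of quotient and conjugate
  is thus reduced in the sense of Gauss.\<close>

lemma conj_quotient_bounds:
  assumes "\<alpha> \<notin> \<rat>"
  shows "-1 < conj_quotient \<alpha> (Suc i) \<and> conj_quotient \<alpha> (Suc i) < 0"
proof (induction i)
  case 0
  then show ?case by (simp add: conj_quotient.simps(2))
next
  case (Suc i)
  define d where "d = conj_quotient \<alpha> (Suc i) - of_int (partial_quotient \<alpha> (Suc i))"
  have "d < -1"
    using Suc partial_quotient_ge_1[OF assms, of i] unfolding d_def by linarith
  then have "-1 < 1 / d \<and> 1 / d < 0"
    by (simp add: field_simps)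
  then show ?case by (simp add: d_def conj_quotient.simps(2))
qed

text \<open>Substituting x = a + 1 / x' turns m x - k into -(n x' - m) / x' with n = k - a m, and
  likewise for the conjugate y. The denominators x' and y' cancel against those of x - y.\<close>

lemma form_step:
  assumes "\<alpha> \<notin> \<rat>"
  shows "form \<alpha> i m k = form \<alpha> (Suc i) (k - partial_quotient \<alpha> i * m) m"
proof -
  define x where "x = complete_quotient \<alpha> (Suc i)"
  define y where "y = conj_quotient \<alpha> (Suc i)"
  define a where "a = partial_quotient \<alpha> i"
  define n where "n = k - a * m"
  have x: "x > 1" unfolding x_def by (rule complete_quotient_Suc_gt_1[OF assms])
  have y: "y < 0" unfolding y_def using conj_quotient_bounds[OF assms] by blast
  have X: "complete_quotient \<alpha> i = of_int a + 1 / x"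
    unfolding a_def x_def by (rule complete_quotient_eq)
  have Y: "conj_quotient \<alpha> i = of_int a + 1 / y"
    by (simp add: y_def a_def conj_quotient.simps(2))
  have 1: "of_int m * complete_quotient \<alpha> i - of_int k = - (of_int n * x - of_int m) / x"
    using x by (simp add: X n_def field_simps)
  have 2: "of_int m * conj_quotient \<alpha> i - of_int k = - (of_int n * y - of_int m) / y"
    using y by (simp add: Y n_def field_simps)
  have 3: "complete_quotient \<alpha> i - conj_quotient \<alpha> i = (x - y) / (x * \<bar>y\<bar>)"
    using x y by (simp add: X Y field_simps)
  show ?thesis
    unfolding form_def 1 2 3 a_def[symmetric] n_def[symmetric] x_def[symmetric] y_def[symmetric]
    using x y by (simp add: abs_mult abs_minus_commute mult.commute)
qed

text \<open>In this cone both linear factors are bounded away from 0 separately: m x - k keeps at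
  least the tail 1 / x' of the quotient, where x' < A + 1 is the next one, and m y - k is at most -1
  because y < 0.\<close>

lemma form_ge:
  assumes "\<alpha> \<notin> \<rat>" and A: "\<And>i. partial_quotient \<alpha> i \<le> A"
    and "1 \<le> m" "1 \<le> k" "k \<le> partial_quotient \<alpha> (Suc i) * m"
  shows "1 / ((of_int A + 1) * (of_int A + 2)) \<le> form \<alpha> (Suc i) m k"
proof -
  let ?x = "complete_quotient \<alpha> (Suc i)" and ?y = "conj_quotient \<alpha> (Suc i)"
  have cq: "complete_quotient \<alpha> j < of_int A + 1" for j
    using A[of j] unfolding partial_quotient_def by linarith
  have "A \<ge> 1"
    using A[of 1] partial_quotient_ge_1[OF assms(1), of 0] by simp
  have "1 / (of_int A + 1) \<le> 1 / complete_quotient \<alpha> (Suc (Suc i))"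
    using cq[of "Suc (Suc i)"] complete_quotient_Suc_gt_1[OF assms(1), of "Suc i"]
    by (intro divide_left_mono mult_pos_pos) auto
  also have "\<dots> \<le> of_int m * (1 / complete_quotient \<alpha> (Suc (Suc i)))"
    using assms(3) complete_quotient_Suc_gt_1[OF assms(1), of "Suc i"]
    by (intro mult_le_cancel_right1[THEN iffD2]) auto
  also have "\<dots> \<le> of_int m * ?x - of_int k"
  proof -
    have "of_int k \<le> real_of_int (partial_quotient \<alpha> (Suc i)) * of_int m"
      using assms(5) by (metis of_int_le_iff of_int_mult)
    then show ?thesis
      unfolding complete_quotient_eq[of \<alpha> "Suc i"] by (simp add: algebra_simps)
  qed
  finally have 1: "1 / (of_int A + 1) \<le> \<bar>of_int m * ?x - of_int k\<bar>"
    by linarith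
  have y: "-1 < ?y" "?y < 0"
    using conj_quotient_bounds[OF assms(1), of i] by auto
  have "of_int m * ?y < 0"
    using assms(3) y(2) by (simp add: mult_pos_neg)
  then have 2: "1 \<le> \<bar>of_int m * ?y - of_int k\<bar>"
    using assms(4) by linarith
  have 3: "0 < ?x - ?y" "?x - ?y < of_int A + 2"
    using cq[of "Suc i"] y complete_quotient_Suc_gt_1[OF assms(1), of i] by linarith+
  have "1 / ((of_int A + 1) * (of_int A + 2)) = 1 / (of_int A + 1) * 1 / (real_of_int A + 2)"
    by simp
  also have "\<dots> \<le> form \<alpha> (Suc i) m k"
    unfolding form_def using 1 2 3 \<open>A \<ge> 1\<close>
    by (intro frac_le mult_mono) auto
  finally show ?thesis .
qed

text \<open>Euclidean descent: as long as k > a m, one step of the algorithm replaces (m, k) by the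
  positive pair (k - a m, m), which either has a smaller first entry or lies in the cone where
  \<open>form_ge\<close> applies at once.\<close>

lemma form_lower_bound:
  assumes "\<alpha> \<notin> \<rat>" and A: "\<And>i. partial_quotient \<alpha> i \<le> A"
    and "1 \<le> m" "1 \<le> k"
  shows "1 / ((of_int A + 1) * (of_int A + 2)) \<le> form \<alpha> (Suc i) m k"
  using assms(3,4)
proof (induction "nat m" arbitrary: i m k rule: less_induct)
  case less
  define n where "n = k - partial_quotient \<alpha> (Suc i) * m"
  show ?case
  proof (cases "n \<le> 0")
    case True
    then show ?thesis
      using form_ge[OF assms(1) A less.prems] unfolding n_def by simp
  next
    case False
    then have "1 \<le> n" by simp
    have "1 / ((of_int A + 1) * (of_int A + 2)) \<le> form \<alpha> (Suc (Suc i)) n m"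
    proof (cases "n < m")
      case True
      then show ?thesis
        using less.hyps[of n m "Suc i"] \<open>1 \<le> n\<close> less.prems by simp
    next
      case False
      have "1 * n \<le> partial_quotient \<alpha> (Suc (Suc i)) * n"
        using partial_quotient_ge_1[OF assms(1), of "Suc i"] \<open>1 \<le> n\<close>
        by (intro mult_right_mono) auto
      then have "m \<le> partial_quotient \<alpha> (Suc (Suc i)) * n"
        using False by linarith
      then show ?thesis
        using form_ge[OF assms(1) A] \<open>1 \<le> n\<close> less.prems by simp
    qed
    then show ?thesis
      unfolding form_step[OF assms(1), of "Suc i"] n_def .
  qed
qed

lemma badly_approximable_imp_bad_form:
  assumes "badly_approximable \<alpha>"
  shows "bad_form \<alpha>"
proof -
  obtain A where irr: "\<alpha> \<notin> \<rat>" and A: "\<And>i. partial_quotient \<alpha> i \<le> A"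
    using assms unfolding badly_approximable_def by blast
  define a where "a = partial_quotient \<alpha> 0"
  define N where "N m k = \<bar>real_of_int m\<bar> + \<bar>real_of_int k\<bar>" for m k
  define c0 where "c0 = 1 / ((real_of_int A + 1) * (of_int A + 2))"
  \<comment> \<open>\<open>B\<close> compares the conjugate factor at index 0 with the size of the
    vector: |m (a - 2) - k| <= B (|m| + |k|).\<close>
  define B where "B = \<bar>real_of_int a\<bar> + 3"
  define c where "c = c0 / B"
  have "A \<ge> 1"
    using A[of 1] partial_quotient_ge_1[OF irr, of 0] by simp
  then have "0 < (real_of_int A + 1) * (of_int A + 2)"
    by (intro mult_pos_pos) auto
  moreover have "1 / ((real_of_int A + 1) * (of_int A + 2)) \<le> 1 / ((real_of_int A + 1) * 1)"
    using \<open>A \<ge> 1\<close> by (intro divide_left_mono mult_left_mono mult_pos_pos) auto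
  ultimately have c0: "0 < c0" "c0 \<le> 1 / (of_int A + 1)"
    unfolding c0_def by auto
  have B: "B \<ge> 3" unfolding B_def by simp
  then have c: "0 < c" "c \<le> c0"
    unfolding c_def using c0 by (auto simp: field_simps)
  have f0: "1 / (of_int A + 1) \<le> frac \<alpha>"
  proof -
    have "1 / frac \<alpha> < of_int A + 1"
      using A[of 1] unfolding partial_quotient_def
      by (simp add: complete_quotient.simps(2)) linarith
    then show ?thesis
      using frac_irrational_pos[OF irr] \<open>A \<ge> 1\<close> by (simp add: field_simps)
  qed
  have A1: "real_of_int A \<ge> 1" using \<open>A \<ge> 1\<close> by simp
  have al: "\<alpha> = of_int a + frac \<alpha>"
    by (simp add: a_def partial_quotient_def frac_def)
  have pos: "c \<le> \<bar>real_of_int m * \<alpha> - real_of_int k\<bar> * N m k" if "1 \<le> m" for m k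
  \<comment> \<open>The lower bound for the form holds for vectors that are positive after one step,
    so k <= a m is treated apart: there m \<alpha> - k is at least the fractional part of
    \<alpha>.\<close>
  proof (cases "k - a * m \<le> 0")
    case True
    have "real_of_int k \<le> of_int a * of_int m"
      using True by (metis diff_le_0_iff_le of_int_le_iff of_int_mult)
    then have "real_of_int m * frac \<alpha> \<le> real_of_int m * \<alpha> - real_of_int k"
      by (subst (2) al) (simp add: algebra_simps)
    moreover have "1 * frac \<alpha> \<le> real_of_int m * frac \<alpha>"
      using that by (intro mult_right_mono) auto
    ultimately have "c \<le> \<bar>real_of_int m * \<alpha> - real_of_int k\<bar>"
      using c c0 f0 by linarith
    moreover have "1 \<le> N m k"
      using that unfolding N_def by simp
    ultimately show ?thesis
      using c mult_mono[of c "\<bar>real_of_int m * \<alpha> - real_of_int k\<bar>" 1 "N m k"] by simp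
  next
    case False
    then have "c0 \<le> form \<alpha> 0 m k"
      unfolding form_step[OF irr, of 0] c0_def a_def
      using that by (intro form_lower_bound[OF irr A]) auto
    also have "\<dots> = \<bar>real_of_int m * \<alpha> - of_int k\<bar> * \<bar>of_int m * (of_int a - 2) - of_int k\<bar> / (frac \<alpha> + 2)"
      unfolding form_def a_def[symmetric] by (simp add: a_def[symmetric] al[symmetric]) (metis add_diff_cancel_left' al)
    also have "\<dots> \<le> \<bar>real_of_int m * \<alpha> - of_int k\<bar> * (B * N m k) / 1"
    proof (intro frac_le mult_left_mono)
      have "\<bar>real_of_int m * (of_int a - 2) - of_int k\<bar> \<le> \<bar>real_of_int m\<bar> * \<bar>of_int a - 2\<bar> + \<bar>real_of_int k\<bar>"
        by (metis abs_mult abs_triangle_ineq4)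
      also have "\<dots> \<le> \<bar>real_of_int m\<bar> * B + \<bar>real_of_int k\<bar> * B"
        using B unfolding B_def by (intro add_mono mult_left_mono) (auto simp: mult_le_cancel_left1)
      finally show "\<bar>real_of_int m * (of_int a - 2) - of_int k\<bar> \<le> B * N m k"
        unfolding N_def by (simp add: algebra_simps)
    qed (use frac_ge_0[of \<alpha>] B in \<open>auto simp: N_def\<close>)
    finally show ?thesis
      unfolding c_def using B by (simp add: field_simps)
  qed
  have "c \<le> \<bar>real_of_int m * \<alpha> - real_of_int k\<bar> * N m k" if "(m, k) \<noteq> (0, 0)" for m k
  proof -
    consider "m \<ge> 1" | "m = 0" | "- m \<ge> 1" by linarith
    then show ?thesis
    proof cases
      case 1
      then show ?thesis by (rule pos)
    next
      case 2
      then have "1 \<le> \<bar>real_of_int k\<bar>" using that by auto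
      then have "1 * 1 \<le> \<bar>real_of_int k\<bar> * \<bar>real_of_int k\<bar>"
        by (intro mult_mono) auto
      moreover have "c \<le> 1" using c c0 A1 by (smt (verit) divide_le_eq_1)
      ultimately show ?thesis using 2 unfolding N_def by simp
    next
      case 3
      then show ?thesis
        using pos[of "-m" "-k"] unfolding N_def by (simp add: abs_minus_commute)
    qed
  qed
  then show ?thesis
    unfolding bad_form_def N_def using c by blast
qed

text \<open>Undoing a step sends (m, k) to (k, m + a k), which preserves positivity when a >= 1. The
  pull-back stops at index 1 since the partial quotient at index 0 may be 0 or negative.\<close>

lemma form_pull_back:
  assumes "\<alpha> \<notin> \<rat>" "1 \<le> m" "1 \<le> k"
  shows "\<exists>m' k'. 1 \<le> m' \<and> 1 \<le> k' \<and> form \<alpha> (Suc 0) m' k' = form \<alpha> (Suc i) m k"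
  using assms(2,3)
proof (induction i arbitrary: m k)
  case 0
  then show ?case by blast
next
  case (Suc i)
  let ?a = "partial_quotient \<alpha> (Suc i)"
  have "1 \<le> m + ?a * k"
    using Suc.prems partial_quotient_ge_1[OF assms(1), of i]
    by (smt (verit) mult_nonneg_nonneg)
  then show ?case
    using Suc.IH[of k "m + ?a * k"] Suc.prems form_step[OF assms(1), of "Suc i" k "m + ?a * k"]
    by simp
qed

lemma bad_form_imp_badly_approximable:
  assumes "bad_form \<alpha>"
  shows "badly_approximable \<alpha>"
proof -
  have irr: "\<alpha> \<notin> \<rat>" by (rule bad_form_irrational[OF assms])
  obtain c where "c > 0" and c: "\<And>m k :: int. (m, k) \<noteq> (0, 0) \<Longrightarrow>
     c \<le> \<bar>real_of_int m * \<alpha> - real_of_int k\<bar> * (\<bar>real_of_int m\<bar> + \<bar>real_of_int k\<bar>)"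
    using assms unfolding bad_form_def by blast
  define a where "a = partial_quotient \<alpha> 0"
  \<comment> \<open>Chosen so that |k| + |k0| <= B (m + 2 k), where m + 2 k is the conjugate factor
    of the vector pulled back to index 0.\<close>
  define B where "B = \<bar>real_of_int a\<bar> + 1"
  have B: "B \<ge> 1" unfolding B_def by simp
  have al: "\<alpha> = of_int a + frac \<alpha>"
    by (simp add: a_def partial_quotient_def frac_def)
  have bound: "complete_quotient \<alpha> (Suc (Suc i)) \<le> 3 * B / c" for i
  proof -
    let ?a = "partial_quotient \<alpha> (Suc i)" and ?f = "frac (complete_quotient \<alpha> (Suc i))"
    let ?x = "complete_quotient \<alpha> (Suc i)" and ?y = "conj_quotient \<alpha> (Suc i)"
    \<comment> \<open>The vector (1, a) makes the first linear factor at index \<open>Suc i\<close>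
      equal to the fractional part, the reciprocal of the next complete quotient. Pulled back to
      index 0 it is a convergent, so a large quotient forces a small value of the form at an integer
      vector.\<close>
    obtain m k where mk: "1 \<le> m" "1 \<le> k" "form \<alpha> (Suc 0) m k = form \<alpha> (Suc i) 1 ?a"
      using form_pull_back[OF irr order_refl partial_quotient_ge_1[OF irr], of i i] by blast
    have f: "?x = of_int ?a + ?f" "0 < ?f"
      using frac_irrational_pos[OF complete_quotient_irrational[OF irr]]
      by (simp_all add: partial_quotient_def frac_def)
    have y: "-1 < ?y" "?y < 0"
      using conj_quotient_bounds[OF irr, of i] by auto
    have a1: "1 \<le> real_of_int ?a"
      using partial_quotient_ge_1[OF irr, of i] by simp
    have "form \<alpha> (Suc i) 1 ?a = ?f * ((of_int ?a - ?y) / (?x - ?y))"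
    proof -
      have "1 * ?x - of_int ?a = ?f" "1 * ?y - of_int ?a = - (of_int ?a - ?y)"
        using f(1) by linarith+
      then show ?thesis
        unfolding form_def of_int_1 using f(2) y a1
        by (simp only: abs_minus_cancel) (simp only: abs_of_pos times_divide_eq_right)
    qed
    also have "\<dots> \<le> ?f * 1"
    proof (intro mult_left_mono)
      have "0 < ?x - ?y" "of_int ?a - ?y \<le> ?x - ?y"
        using f y a1 by linarith+
      then show "(of_int ?a - ?y) / (?x - ?y) \<le> 1"
        by (metis divide_le_eq_1_pos)
    qed (use f in linarith)
    finally have 1: "form \<alpha> (Suc i) 1 ?a \<le> ?f" by simp
    define k0 where "k0 = m + a * k"
    have "form \<alpha> 0 k k0 = form \<alpha> (Suc 0) m k"
      using form_step[OF irr, of 0 k k0] by (simp add: k0_def a_def)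
    with mk 1 have 2: "form \<alpha> 0 k k0 \<le> ?f" by simp
    have 3: "form \<alpha> 0 k k0 = \<bar>real_of_int k * \<alpha> - of_int k0\<bar> * (of_int m + 2 * of_int k) / (frac \<alpha> + 2)"
    proof -
      have "\<bar>real_of_int k * (of_int a - 2) - of_int k0\<bar> = of_int m + 2 * of_int k"
        using mk by (simp add: k0_def algebra_simps)
      moreover have "\<alpha> - (of_int a - 2) = frac \<alpha> + 2"
        using al by linarith
      ultimately show ?thesis
        unfolding form_def by (simp add: a_def[symmetric])
    qed
    have "c \<le> \<bar>real_of_int k * \<alpha> - of_int k0\<bar> * (\<bar>real_of_int k\<bar> + \<bar>real_of_int k0\<bar>)"
      using c[of k k0] mk by simp
    also have "\<dots> \<le> \<bar>real_of_int k * \<alpha> - of_int k0\<bar> * (B * (of_int m + 2 * of_int k))"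
    proof (intro mult_left_mono)
      have "\<bar>real_of_int k0\<bar> \<le> of_int m + \<bar>of_int a\<bar> * of_int k"
        using mk abs_triangle_ineq[of "real_of_int m" "of_int a * of_int k"]
        by (simp add: k0_def abs_mult)
      moreover have "0 \<le> \<bar>real_of_int a\<bar> * of_int k" "0 \<le> \<bar>real_of_int a\<bar> * of_int m"
        using mk by simp_all
      moreover have "B * (of_int m + 2 * of_int k) = of_int m + 2 * of_int k
          + \<bar>real_of_int a\<bar> * of_int m + 2 * (\<bar>real_of_int a\<bar> * of_int k)"
        by (simp add: B_def algebra_simps)
      moreover have "1 \<le> real_of_int k"
        using mk by simp
      ultimately show "\<bar>real_of_int k\<bar> + \<bar>real_of_int k0\<bar> \<le> B * (of_int m + 2 * of_int k)"
        by linarith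
    qed simp
    also have "\<dots> = B * (frac \<alpha> + 2) * form \<alpha> 0 k k0"
    proof -
      have "frac \<alpha> + 2 \<noteq> 0" using frac_ge_0[of \<alpha>] by linarith
      then show ?thesis unfolding 3 by simp
    qed
    also have "\<dots> \<le> B * 3 * ?f"
    proof (intro mult_mono)
      show "frac \<alpha> + 2 \<le> 3" using frac_lt_1[of \<alpha>] by linarith
      show "0 \<le> form \<alpha> 0 k k0" unfolding 3 using mk frac_ge_0[of \<alpha>] by simp
    qed (use B 2 frac_ge_0[of \<alpha>] in auto)
    finally have "1 / ?f \<le> 3 * B / c"
      using f(2) \<open>c > 0\<close> by (simp add: field_simps del: frac_gt_0_iff)
    then show ?thesis
      by (simp add: complete_quotient.simps(2))
  qed
  \<comment> \<open>\<open>bound\<close> starts with the quotient of index 2, so the indices 0 and 1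
    enter the maximum directly.\<close>
  define A where "A = max (partial_quotient \<alpha> 0) (max (partial_quotient \<alpha> 1) \<lfloor>3 * B / c\<rfloor>)"
  have "partial_quotient \<alpha> i \<le> A" for i
  proof -
    consider "i = 0" | "i = 1" | j where "i = Suc (Suc j)"
      by (metis One_nat_def not0_implies_Suc)
    then show ?thesis
    proof cases
      case 3
      then show ?thesis
        unfolding A_def partial_quotient_def using floor_mono[OF bound[of j]] by simp
    qed (auto simp: A_def)
  qed
  then show ?thesis
    unfolding badly_approximable_def using irr by blast
qed

lemma badly_approximable_iff_bad_form: "badly_approximable \<alpha> \<longleftrightarrow> bad_form \<alpha>"
  using badly_approximable_imp_bad_form bad_form_imp_badly_approximable by blast

section \<open>Skew products over two-interval exchanges\<close>


record 's exchange =
  perm :: "bool \<Rightarrow> 's \<Rightarrow> 's"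
  len :: "bool \<Rightarrow> real"

text \<open>The exchange acts on the interval from \<open>- len E False\<close> to \<open>len E True\<close>: its left part, of length
  \<open>len E True\<close> and with letter \<open>True\<close>, is moved to the right end, and the rest to the left end. The origin is
  the point where the images of the two parts meet, and it remains so under \<open>renorm\<close>.\<close>

definition letter :: "'s exchange \<Rightarrow> 's \<times> real \<Rightarrow> bool" where
  "letter E p \<longleftrightarrow> snd p < len E True - len E False"

definition shift :: "'s exchange \<Rightarrow> bool \<Rightarrow> real" where
  "shift E b = (if b then len E False else - len E True)"

definition step :: "'s exchange \<Rightarrow> 's \<times> real \<Rightarrow> 's \<times> real" where
  "step E p = (perm E (letter E p) (fst p), snd p + shift E (letter E p))"

definition states :: "'s set \<Rightarrow> 's exchange \<Rightarrow> ('s \<times> real) set" where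
  "states S E = S \<times> {- len E False..<len E True}"

text \<open>A tie counts as a win of \<open>False\<close>. In \<open>skew_exchange\<close> ties are
  excluded, because they would produce a length 0 at the next stage.\<close>

definition winner :: "'s exchange \<Rightarrow> bool" where
  "winner E \<longleftrightarrow> len E False < len E True"

text \<open>One step of Rauzy induction: the first return to the part of the interval that carries
  the winning letter. A return with the losing letter follows the winner and then the loser, hence
  the composed permutation.\<close>

definition renorm :: "'s exchange \<Rightarrow> 's exchange" where
  "renorm E = (let c = winner E in
     \<lparr>perm = (perm E)(\<not> c := perm E (\<not> c) \<circ> perm E c),
      len = (len E)(c := len E c - len E (\<not> c))\<rparr>)"

lemma perm_renorm:
  "perm (renorm E) b = (if b = winner E then perm E b else perm E b \<circ> perm E (winner E))"
  by (auto simp: renorm_def Let_def)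

lemma len_renorm:
  "len (renorm E) b = (if b = winner E then len E b - len E (\<not> b) else len E b)"
  by (auto simp: renorm_def Let_def)

section \<open>Iterated induction: heights and contents of the towers\<close>

abbreviation stage :: "'s exchange \<Rightarrow> nat \<Rightarrow> 's exchange" where
  "stage E k \<equiv> (renorm ^^ k) E"

text \<open>The number of steps of \<open>E\<close> that make up one step of stage \<open>k\<close>
  with letter \<open>b\<close>; see \<open>step_stage\<close>.\<close>

fun height :: "'s exchange \<Rightarrow> nat \<Rightarrow> bool \<Rightarrow> nat" where
  "height E 0 b = 1"
| "height E (Suc k) b =
     (if b = winner (stage E k) then height E k b else height E k True + height E k False)"

text \<open>The pairs of fibre and letter met on the floors of the tower over fibre \<open>s\<close>
  and letter \<open>b\<close>. In a loser's tower the winner's floors come first, so the old loser's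
  floors start in the fibre moved by the winner's permutation.\<close>

fun visited :: "'s exchange \<Rightarrow> nat \<Rightarrow> bool \<Rightarrow> 's \<Rightarrow> ('s \<times> bool) set" where
  "visited E 0 b s = {(s, b)}"
| "visited E (Suc k) b s = (let c = winner (stage E k) in
     if b = c then visited E k b s
     else visited E k c s \<union> visited E k b (perm (stage E k) c s))"

text \<open>\<open>ratio\<close> is bounded type in renormalised form. It is imposed on all stages
  so that every stage is an instance with the same \<open>S\<close> and \<open>\<rho>\<close>; this
  makes the constants below independent of the stage.\<close>

locale skew_exchange =
  fixes S :: "'s set" and E :: "'s exchange" and \<rho> :: real
  assumes finite_S: "finite S"
    and bij: "bij_betw (perm E b) S S"
    and transitive: "\<lbrakk>A \<subseteq> S; A \<noteq> {}; \<And>b. perm E b ` A \<subseteq> A\<rbrakk> \<Longrightarrow> A = S"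
    and len_pos: "0 < len (stage E k) b"
    and ratio: "len (stage E k) b \<le> \<rho> * len (stage E k) (\<not> b)"
begin

lemma len_loser_less: "len E (\<not> winner E) < len E (winner E)"
proof (cases "winner E")
  case True
  then show ?thesis by (simp add: winner_def)
next
  case False
  moreover have "0 < len (renorm E) (winner E)"
    using len_pos[of "Suc 0"] by simp
  ultimately show ?thesis
    by (simp add: perm_renorm len_renorm)
qed

lemma lens_pos: "0 < len E True" "0 < len E False"
  using len_pos[of 0 True] len_pos[of 0 False] by simp_all

lemma perm_in: "s \<in> S \<Longrightarrow> perm E b s \<in> S"
  using bij bij_betwE by blast

lemma renorm_skew_exchange: "skew_exchange S (renorm E) \<rho>"
proof
  show "finite S" by (rule finite_S)
  show "bij_betw (perm (renorm E) b) S S" for b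
    using bij[of True] bij[of False] bij_betw_trans[OF bij[of "winner E"] bij[of "\<not> winner E"]]
    by (cases b; cases "winner E") (simp_all add: perm_renorm len_renorm)
  show "0 < len (stage (renorm E) k) b" for k b
    using len_pos[of "Suc k" b] unfolding funpow_Suc_right comp_apply .
  show "len (stage (renorm E) k) b \<le> \<rho> * len (stage (renorm E) k) (\<not> b)" for k b
    using ratio[of "Suc k" b] unfolding funpow_Suc_right comp_apply .
next
  fix A assume A: "A \<subseteq> S" "A \<noteq> {}" and inv: "\<And>b. perm (renorm E) b ` A \<subseteq> A"
  define c where "c = winner E"
  have c: "perm E c ` A \<subseteq> A"
    using inv[of c] by (simp add: perm_renorm len_renorm c_def)
  have "inj_on (perm E c) A"
    using A(1) bij[of c] unfolding bij_betw_def by (blast intro: inj_on_subset)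
  \<comment> \<open>An injection that maps a finite set into itself maps it onto itself; this
    cancels the winner's permutation from the composed one.\<close>
  then have eq: "perm E c ` A = A"
    by (rule endo_inj_surj[OF finite_subset[OF A(1) finite_S] c])
  have "perm E (\<not> c) ` perm E c ` A \<subseteq> A"
    using inv[of "\<not> c"] by (simp add: perm_renorm len_renorm c_def image_comp)
  then have "perm E b ` A \<subseteq> A" for b
    using eq c by (cases "b = c") simp_all
  then show "A = S"
    by (rule transitive[OF A])
qed

lemma renorm_states:
  "p \<in> states S (renorm E) \<longleftrightarrow> p \<in> states S E \<and> letter E p = winner E"
  using lens_pos
  by (cases "winner E"; cases p) (auto simp: states_def len_renorm letter_def)

lemma step_states: "p \<in> states S E \<Longrightarrow> step E p \<in> states S E"
  using lens_pos
  by (cases p) (auto simp: states_def step_def letter_def shift_def perm_in)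

lemma step_renorm_winner:
  assumes "p \<in> states S (renorm E)" "letter (renorm E) p = winner E"
  shows "step (renorm E) p = step E p"
  using assms renorm_states[of p]
  by (cases "winner E") (auto simp: step_def shift_def perm_renorm len_renorm letter_def)

lemma step_renorm_loser:
  assumes "p \<in> states S (renorm E)" "letter (renorm E) p = (\<not> winner E)"
  shows "letter E (step E p) = (\<not> winner E)" "step (renorm E) p = step E (step E p)"
proof -
  have c: "letter E p = winner E"
    using assms(1) renorm_states by blast
  show l: "letter E (step E p) = (\<not> winner E)"
    using assms(2) c
    by (cases "winner E") (auto simp: step_def shift_def perm_renorm len_renorm letter_def)
  have "step E (step E p) = (perm E (\<not> winner E) (perm E (winner E) (fst p)),
      snd p + shift E (winner E) + shift E (\<not> winner E))"
    using c l by (simp add: step_def)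
  moreover have "step (renorm E) p = (perm (renorm E) (\<not> winner E) (fst p),
      snd p + shift (renorm E) (\<not> winner E))"
    using assms(2) by (simp add: step_def)
  ultimately show "step (renorm E) p = step E (step E p)"
    by (cases "winner E") (auto simp: shift_def perm_renorm len_renorm)
qed

text \<open>Points with the losing letter lie outside the induced domain, so a tower that was based
  at such a point has to be rebased at its predecessor, which carries the winning letter.\<close>

lemma loser_preimage:
  assumes "(s, t) \<in> states S E" "letter E (s, t) = (\<not> winner E)"
  obtains s' where "s' \<in> S" "perm E (winner E) s' = s"
    "(s', t - shift E (winner E)) \<in> states S (renorm E)"
    "letter (renorm E) (s', t - shift E (winner E)) = (\<not> winner E)"
proof -
  obtain s' where s': "s' \<in> S" "perm E (winner E) s' = s"
    using assms(1) bij[of "winner E"] unfolding states_def bij_betw_def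
    by (metis SigmaD1 imageE)
  moreover have "(s', t - shift E (winner E)) \<in> states S (renorm E) \<and>
    letter (renorm E) (s', t - shift E (winner E)) = (\<not> winner E)"
    using assms s' lens_pos len_loser_less
    by (cases "winner E") (auto simp: states_def perm_renorm len_renorm letter_def shift_def)
  ultimately show ?thesis using that by blast
qed

end

lemma skew_exchange_stage:
  assumes "skew_exchange S E \<rho>"
  shows "skew_exchange S (stage E k) \<rho>"
proof (induction k)
  case (Suc k)
  then show ?case using skew_exchange.renorm_skew_exchange by simp
qed (use assms in simp)

context skew_exchange
begin

lemma height_Suc_loser:
  "height E (Suc k) (\<not> winner (stage E k)) =
     height E k (winner (stage E k)) + height E k (\<not> winner (stage E k))"
  by (cases "winner (stage E k)") auto

lemma height_le: "height E k b \<le> 2 ^ k"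
proof (induction k arbitrary: b)
  case (Suc k)
  show ?case
    using Suc[of True] Suc[of False] by (cases b) auto
qed simp

lemma step_stage:
  "p \<in> states S (stage E k) \<Longrightarrow> (step E ^^ height E k (letter (stage E k) p)) p = step (stage E k) p"
proof (induction k arbitrary: p)
  case (Suc k)
  interpret F: skew_exchange S "stage E k" \<rho>
    by (rule skew_exchange_stage[OF skew_exchange_axioms])
  let ?c = "winner (stage E k)"
  have p: "p \<in> states S (renorm (stage E k))"
    using Suc.prems by simp
  then have p': "p \<in> states S (stage E k)" "letter (stage E k) p = ?c"
    using F.renorm_states by auto
  show ?case
  proof (cases "letter (stage E (Suc k)) p = ?c")
    case True
    then show ?thesis
      using F.step_renorm_winner[OF p] Suc.IH[OF p'(1)] p' by simp
  next
    case False
    then have l: "letter (renorm (stage E k)) p = (\<not> ?c)" by auto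
    have "step (renorm (stage E k)) p = step (stage E k) (step (stage E k) p)"
      by (rule F.step_renorm_loser(2)[OF p l])
    also have "\<dots> = (step E ^^ height E k (\<not> ?c)) (step (stage E k) p)"
      using Suc.IH[OF F.step_states[OF p'(1)]] F.step_renorm_loser(1)[OF p l] by simp
    also have "\<dots> = (step E ^^ (height E k (\<not> ?c) + height E k ?c)) p"
      using Suc.IH[OF p'(1)] p'(2) by (simp add: funpow_add)
    finally show ?thesis
      using l height_Suc_loser[of k] by (simp add: add.commute)
  qed
qed simp

lemma visited_reached:
  assumes "p \<in> states S (stage E k)" "(s, b) \<in> visited E k (letter (stage E k) p) (fst p)"
  shows "\<exists>j < height E k (letter (stage E k) p).
    (step E ^^ j) p \<in> states S E \<and> fst ((step E ^^ j) p) = s \<and> letter E ((step E ^^ j) p) = b"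
  using assms
proof (induction k arbitrary: p)
  case 0
  then show ?case by auto
next
  case (Suc k)
  interpret F: skew_exchange S "stage E k" \<rho>
    by (rule skew_exchange_stage[OF skew_exchange_axioms])
  let ?c = "winner (stage E k)"
  have p: "p \<in> states S (renorm (stage E k))"
    using Suc.prems by simp
  then have p': "p \<in> states S (stage E k)" "letter (stage E k) p = ?c"
    using F.renorm_states by auto
  show ?case
  proof (cases "letter (stage E (Suc k)) p = ?c")
    case True
    then show ?thesis
      using Suc.IH[OF p'(1)] Suc.prems(2) p' by simp
  next
    case False
    then have l: "letter (renorm (stage E k)) p = (\<not> ?c)" by auto
    have vis: "(s, b) \<in> visited E k ?c (fst p) \<or> (s, b) \<in> visited E k (\<not> ?c) (perm (stage E k) ?c (fst p))"
      using Suc.prems(2) l by (auto simp: Let_def)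
    have h: "height E (Suc k) (letter (stage E (Suc k)) p) = height E k ?c + height E k (\<not> ?c)"
      using l height_Suc_loser[of k] by simp
    from vis show ?thesis
    proof
      assume "(s, b) \<in> visited E k ?c (fst p)"
      then show ?thesis
        unfolding h using Suc.IH[OF p'(1)] p'(2) by (auto intro: trans_less_add1)
    next
      assume v: "(s, b) \<in> visited E k (\<not> ?c) (perm (stage E k) ?c (fst p))"
      let ?p = "step (stage E k) p"
      have "?p \<in> states S (stage E k)" "letter (stage E k) ?p = (\<not> ?c)"
        using F.step_states[OF p'(1)] F.step_renorm_loser(1)[OF p l] by auto
      moreover have "fst ?p = perm (stage E k) ?c (fst p)"
        using p'(2) by (simp add: step_def)
      ultimately obtain j where j: "j < height E k (\<not> ?c)" "(step E ^^ j) ?p \<in> states S E"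
         "fst ((step E ^^ j) ?p) = s" "letter E ((step E ^^ j) ?p) = b"
        using Suc.IH[of ?p] v by auto
      have "?p = (step E ^^ height E k ?c) p"
        using step_stage[OF p'(1)] p'(2) by simp
      then have "(step E ^^ j) ?p = (step E ^^ (j + height E k ?c)) p"
        by (simp add: funpow_add)
      then show ?thesis
        unfolding h using j by (intro exI[of _ "j + height E k ?c"]) simp
    qed
  qed
qed

text \<open>The floors of a tower are translates of its base, so an orbit that meets the base in the right
  fibre comes as close to the target as the base is wide.\<close>

lemma tower_floor:
  assumes "(s, t) \<in> states S E"
  shows "\<exists>s0 t0. (s0, t0) \<in> states S (stage E k) \<and>
    (\<forall>u. (s0, u) \<in> states S (stage E k) \<and> letter (stage E k) (s0, u) = letter (stage E k) (s0, t0) \<longrightarrow>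
      (\<exists>j \<le> height E k (letter (stage E k) (s0, t0)). (step E ^^ j) (s0, u) = (s, t + (u - t0))))"
proof (induction k)
  case 0
  show ?case
    using assms by (intro exI[of _ s] exI[of _ t]) (auto intro!: exI[of _ 0])
next
  case (Suc k)
  interpret F: skew_exchange S "stage E k" \<rho>
    by (rule skew_exchange_stage[OF skew_exchange_axioms])
  let ?F = "stage E k" and ?G = "renorm (stage E k)"
  let ?c = "winner (stage E k)"
  obtain s0 t0 where st: "(s0, t0) \<in> states S ?F" and
    reach: "\<And>u. (s0, u) \<in> states S ?F \<Longrightarrow> letter ?F (s0, u) = letter ?F (s0, t0) \<Longrightarrow>
      \<exists>j \<le> height E k (letter ?F (s0, t0)). (step E ^^ j) (s0, u) = (s, t + (u - t0))"
    using Suc.IH by blast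
  show ?case
  proof (cases "letter ?F (s0, t0) = ?c")
    \<comment> \<open>A base with the winning letter stays in the domain, and whichever letter it
      gets there, the new tower starts with the old winner's floors.\<close>
    case True
    then have "(s0, t0) \<in> states S ?G"
      using F.renorm_states st by blast
    moreover have "\<exists>j \<le> height E (Suc k) b. (step E ^^ j) (s0, u) = (s, t + (u - t0))"
      if "(s0, u) \<in> states S ?G" for u b
    proof -
      have "(s0, u) \<in> states S ?F" "letter ?F (s0, u) = ?c"
        using that F.renorm_states by auto
      then obtain j where "j \<le> height E k ?c" "(step E ^^ j) (s0, u) = (s, t + (u - t0))"
        using reach[of u] True by auto
      moreover have "height E k ?c \<le> height E (Suc k) b"
        by (cases "b = ?c"; cases ?c) auto
      ultimately show ?thesis using order_trans by blast
    qed
    ultimately show ?thesis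
      unfolding funpow.simps(2) comp_apply by blast
  next
    \<comment> \<open>A base with the losing letter leaves the domain. The floor now sits above the
      winner's floors over the preimage \<open>s1\<close>, and the base coordinate moves by the
      winner's shift.\<close>
    case False
    then have "letter ?F (s0, t0) = (\<not> ?c)" by auto
    then obtain s1 where s1: "s1 \<in> S" "perm ?F ?c s1 = s0"
      "(s1, t0 - shift ?F ?c) \<in> states S ?G" "letter ?G (s1, t0 - shift ?F ?c) = (\<not> ?c)"
      using F.loser_preimage[OF st] by blast
    have "\<exists>j \<le> height E (Suc k) (\<not> ?c). (step E ^^ j) (s1, u) = (s, t + (u - (t0 - shift ?F ?c)))"
      if u: "(s1, u) \<in> states S ?G" "letter ?G (s1, u) = (\<not> ?c)" for u
    proof -
      have u': "(s1, u) \<in> states S ?F" "letter ?F (s1, u) = ?c"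
        using u F.renorm_states by auto
      then have st: "step ?F (s1, u) = (s0, u + shift ?F ?c)"
        using s1 by (simp add: step_def)
      have "(s0, u + shift ?F ?c) \<in> states S ?F" "letter ?F (s0, u + shift ?F ?c) = (\<not> ?c)"
        using F.step_states[OF u'(1)] F.step_renorm_loser(1)[OF u] unfolding st by auto
      then obtain j where j: "j \<le> height E k (\<not> ?c)"
        "(step E ^^ j) (s0, u + shift ?F ?c) = (s, t + (u + shift ?F ?c - t0))"
        using reach \<open>letter ?F (s0, t0) = (\<not> ?c)\<close> by auto
      have "(step E ^^ (j + height E k ?c)) (s1, u) = (s, t + (u - (t0 - shift ?F ?c)))"
        using step_stage[OF u'(1)] u'(2) st j(2) by (simp add: funpow_add algebra_simps)
      then show ?thesis
        using j(1) height_Suc_loser[of k] by (intro exI[of _ "j + height E k ?c"]) simp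
    qed
    then show ?thesis
      using s1 by (intro exI[of _ s1] exI[of _ "t0 - shift ?F ?c"]) simp
  qed
qed

text \<open>The point lies on some floor of a tower; the remaining climb to the top ends with a
  return to the domain of the stage.\<close>

lemma enters_stage:
  assumes "p \<in> states S E"
  shows "\<exists>j \<le> max (height E k True) (height E k False). (step E ^^ j) p \<in> states S (stage E k)"
proof -
  interpret F: skew_exchange S "stage E k" \<rho>
    by (rule skew_exchange_stage[OF skew_exchange_axioms])
  obtain s t where p: "p = (s, t)" by force
  obtain s0 t0 j where st: "(s0, t0) \<in> states S (stage E k)"
    and j: "j \<le> height E k (letter (stage E k) (s0, t0))" "(step E ^^ j) (s0, t0) = (s, t)"
    using tower_floor[of s t k] assms unfolding p by force
  let ?h = "height E k (letter (stage E k) (s0, t0))"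
  have "(step E ^^ (?h - j)) p = (step E ^^ (?h - j + j)) (s0, t0)"
    unfolding funpow_add using j(2) p by simp
  also have "\<dots> = step (stage E k) (s0, t0)"
    using step_stage[OF st] j(1) by simp
  finally have "(step E ^^ (?h - j)) p \<in> states S (stage E k)"
    using F.step_states[OF st] by simp
  moreover have "?h - j \<le> max (height E k True) (height E k False)"
    by (cases "letter (stage E k) (s0, t0)") auto
  ultimately show ?thesis by blast
qed

lemma stage_winner_len:
  "len (stage E (Suc k)) (winner (stage E k)) =
     len (stage E k) (winner (stage E k)) - len (stage E k) (\<not> winner (stage E k))"
  "len (stage E (Suc k)) (\<not> winner (stage E k)) = len (stage E k) (\<not> winner (stage E k))"
  by (simp_all add: perm_renorm len_renorm)

text \<open>While one letter keeps winning, the other length stays fixed and is subtracted each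
  time; \<open>K + 1\<close> subtractions would exhaust a length that is at most \<open>K\<close>
  times the other.\<close>

lemma no_long_run:
  assumes "\<rho> \<le> real K"
  shows "\<exists>j. 1 \<le> j \<and> j \<le> Suc K \<and> winner (stage E (k + j)) \<noteq> winner (stage E k)"
proof (rule ccontr)
  let ?c = "winner (stage E k)"
  assume "\<not> ?thesis"
  then have run: "winner (stage E (k + j)) = ?c" if "j \<le> Suc K" for j
    using that by (cases "j = 0") auto
  have "len (stage E (k + j)) ?c = len (stage E k) ?c - real j * len (stage E k) (\<not> ?c) \<and>
     len (stage E (k + j)) (\<not> ?c) = len (stage E k) (\<not> ?c)" if "j \<le> Suc K" for j
    using that
  proof (induction j)
    case (Suc j)
    then show ?case
      using stage_winner_len[of "k + j"] run[of j] by (simp add: algebra_simps)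
  qed simp
  from this[of "Suc K"] have "0 < len (stage E k) ?c - real (Suc K) * len (stage E k) (\<not> ?c)"
    using len_pos[of "k + Suc K" ?c] by simp
  moreover have "len (stage E k) ?c \<le> real K * len (stage E k) (\<not> ?c)"
    using ratio[of k ?c] mult_right_mono[OF assms, of "len (stage E k) (\<not> ?c)"] len_pos[of k "\<not> ?c"]
    by linarith
  moreover have "real K * len (stage E k) (\<not> ?c) \<le> real (Suc K) * len (stage E k) (\<not> ?c)"
    using len_pos[of k "\<not> ?c"] by (intro mult_right_mono) auto
  ultimately show False by linarith
qed

end


section \<open>Growth of the visited sets until they are full\<close>

context skew_exchange
begin

text \<open>The potential of the counting argument: a monotone bounded integer can rise only
  boundedly often.\<close>

definition total :: "nat \<Rightarrow> nat" where
  "total k = (\<Sum>b\<in>UNIV. \<Sum>s\<in>S. card (visited E k b s))"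

definition full :: "nat \<Rightarrow> bool" where
  "full k \<longleftrightarrow> (\<forall>b. \<forall>s\<in>S. visited E k b s = S \<times> UNIV)"

lemma perm_stage_in: "s \<in> S \<Longrightarrow> perm (stage E k) b s \<in> S"
  using skew_exchange.perm_in[OF skew_exchange_stage[OF skew_exchange_axioms]] .

lemma visited_subset: "s \<in> S \<Longrightarrow> visited E k b s \<subseteq> S \<times> UNIV"
proof (induction k arbitrary: b s)
  case (Suc k)
  show ?case
    using Suc.IH[OF Suc.prems] Suc.IH[OF perm_stage_in[OF Suc.prems]]
    by (simp add: Let_def)
qed auto

lemma finite_visited: "s \<in> S \<Longrightarrow> finite (visited E k b s)"
  using finite_subset[OF visited_subset] finite_S by (simp add: finite_subset)

lemma visited_winner: "visited E (Suc k) (winner (stage E k)) s = visited E k (winner (stage E k)) s"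
  by simp

lemma visited_loser:
  "visited E (Suc k) (\<not> winner (stage E k)) s = visited E k (winner (stage E k)) s \<union>
     visited E k (\<not> winner (stage E k)) (perm (stage E k) (winner (stage E k)) s)"
  by (simp add: Let_def)

declare visited.simps(2) [simp del]

text \<open>No pair is ever lost: the winner's floors are kept, and the loser's old floors reappear
  over the fibre that the winner's permutation maps to theirs.\<close>

lemma visited_cover:
  assumes "e \<in> S \<times> UNIV"
  shows "\<exists>b. \<exists>s\<in>S. e \<in> visited E k b s"
proof (induction k)
  case 0
  then show ?case using assms by force
next
  case (Suc k)
  interpret F: skew_exchange S "stage E k" \<rho>
    by (rule skew_exchange_stage[OF skew_exchange_axioms])
  let ?c = "winner (stage E k)"
  obtain b s where bs: "s \<in> S" "e \<in> visited E k b s" using Suc by blast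
  show ?case
  proof (cases "b = ?c")
    case True
    then show ?thesis using bs visited_winner by blast
  next
    case False
    then have "b = (\<not> ?c)" by auto
    obtain s0 where "s0 \<in> S" "perm (stage E k) ?c s0 = s"
      using F.bij bs(1) unfolding bij_betw_def by (metis imageE)
    then have "e \<in> visited E (Suc k) (\<not> ?c) s0"
      using bs(2) \<open>b = (\<not> ?c)\<close> visited_loser[of k s0] by blast
    then show ?thesis using \<open>s0 \<in> S\<close> by blast
  qed
qed

lemma total_eq:
  "total k = (\<Sum>s\<in>S. card (visited E k c s)) + (\<Sum>s\<in>S. card (visited E k (\<not> c) s))"
  unfolding total_def by (cases c) (auto simp: UNIV_bool)

lemma sum_perm: "(\<Sum>s\<in>S. f (perm (stage E k) b s)) = (\<Sum>s\<in>S. f s)"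
  using skew_exchange.bij[OF skew_exchange_stage[OF skew_exchange_axioms]]
  by (rule sum.reindex_bij_betw)

text \<open>The winner's sets are kept, and those of the loser, reindexed by the winner's
  permutation, only gain the winner's floors. Equal totals therefore force every single gain to be
  empty.\<close>

lemma total_Suc:
  shows "total k \<le> total (Suc k)"
    and "\<lbrakk>total (Suc k) = total k; s \<in> S\<rbrakk> \<Longrightarrow>
      visited E k (winner (stage E k)) s \<subseteq>
        visited E k (\<not> winner (stage E k)) (perm (stage E k) (winner (stage E k)) s)"
proof -
  let ?c = "winner (stage E k)"
  let ?\<pi> = "perm (stage E k) ?c"
  have le: "card (visited E k (\<not> ?c) (?\<pi> s)) \<le> card (visited E (Suc k) (\<not> ?c) s)"
    if "s \<in> S" for s
    using that by (intro card_mono finite_visited) (simp_all add: visited_loser)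
  have eq: "total k = (\<Sum>s\<in>S. card (visited E k ?c s)) +
      (\<Sum>s\<in>S. card (visited E k (\<not> ?c) (?\<pi> s)))"
    unfolding total_eq[of k ?c]
    using sum_perm[of "\<lambda>s. card (visited E k (\<not> ?c) s)" k ?c] by simp
  have eq': "total (Suc k) = (\<Sum>s\<in>S. card (visited E k ?c s)) +
      (\<Sum>s\<in>S. card (visited E (Suc k) (\<not> ?c) s))"
    unfolding total_eq[of "Suc k" ?c] visited_winner ..
  show "total k \<le> total (Suc k)"
    unfolding eq eq' using le by (intro add_left_mono sum_mono) auto
  show "visited E k ?c s \<subseteq> visited E k (\<not> ?c) (?\<pi> s)" if "total (Suc k) = total k" "s \<in> S"
  proof -
    have "(\<Sum>s\<in>S. card (visited E k (\<not> ?c) (?\<pi> s))) = (\<Sum>s\<in>S. card (visited E (Suc k) (\<not> ?c) s))"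
      using that(1) unfolding eq eq' by linarith
    then have "card (visited E k (\<not> ?c) (?\<pi> s)) = card (visited E (Suc k) (\<not> ?c) s)"
      using le that(2) finite_S by (rule sum_mono_inv)
    then have "visited E k (\<not> ?c) (?\<pi> s) = visited E (Suc k) (\<not> ?c) s"
      using that(2) by (intro card_subset_eq finite_visited) (auto simp: visited_loser)
    then show ?thesis
      unfolding visited_loser by blast
  qed
qed

lemma total_mono: "j \<le> k \<Longrightarrow> total j \<le> total k"
  by (rule lift_Suc_mono_le[of total]) (simp_all add: total_Suc(1))

text \<open>Two letters and \<open>card S\<close> fibres index the sets, and each set has at most
  \<open>2 * card S\<close> elements.\<close>

lemma total_le: "total k \<le> 4 * card S * card S"
proof -
  have "card (visited E k b s) \<le> 2 * card S" if "s \<in> S" for b s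
    using card_mono[OF _ visited_subset[OF that], of k b] finite_S by (simp add: card_cartesian_product)
  then have "total k \<le> (\<Sum>b\<in>(UNIV :: bool set). \<Sum>s\<in>S. 2 * card S)"
    unfolding total_def by (intro sum_mono) auto
  then show ?thesis by (simp add: UNIV_bool)
qed

lemma full_Suc:
  assumes "full k"
  shows "full (Suc k)"
proof -
  have "visited E (Suc k) b s = S \<times> UNIV" if "s \<in> S" for b s
    using assms that perm_stage_in[OF that] visited_winner[of k s] visited_loser[of k s]
    unfolding full_def by (cases "b = winner (stage E k)") auto
  then show ?thesis unfolding full_def by blast
qed

lemma full_mono: "j \<le> k \<Longrightarrow> full j \<Longrightarrow> full k"
  by (induction rule: dec_induct[consumes 1]) (auto intro: full_Suc)

text \<open>By transitivity, growth of \<open>V\<close> along both permutations makes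
  \<open>V\<close> constant; since some tower meets any given pair, the constant value is
  everything.\<close>

lemma const_visited_full:
  assumes V: "\<And>b s. s \<in> S \<Longrightarrow> visited E k b s = V s"
    and inv: "\<And>b s. s \<in> S \<Longrightarrow> V s \<subseteq> V (perm (stage E k) b s)"
  shows "full k"
proof -
  interpret F: skew_exchange S "stage E k" \<rho>
    by (rule skew_exchange_stage[OF skew_exchange_axioms])
  have le: "V s \<subseteq> V s'" if "s \<in> S" "s' \<in> S" for s s'
  proof -
    have "{r \<in> S. V s \<subseteq> V r} = S"
    proof (rule F.transitive)
      show "perm (stage E k) b ` {r \<in> S. V s \<subseteq> V r} \<subseteq> {r \<in> S. V s \<subseteq> V r}" for b
        using inv[of _ b] perm_stage_in[of _ k b] by blast
    qed (use that(1) in auto)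
    then show ?thesis using that(2) by blast
  qed
  have "S \<times> UNIV \<subseteq> V s" if "s \<in> S" for s
    using visited_cover[of _ k] V le that by blast
  moreover have "V s \<subseteq> S \<times> UNIV" if "s \<in> S" for s
    using visited_subset[OF that, of k True] V[OF that] by simp
  ultimately show ?thesis
    unfolding full_def using V by blast
qed

text \<open>If nothing new is visited while the winner changes from \<open>c\<close> and back to \<open>c\<close>, then the visited
  sets no longer depend on the letter and are invariant under both permutations.\<close>

lemma stagnation_full:
  assumes stag: "total (Suc (Suc (k + n))) = total k"
    and c: "winner (stage E k) = c" "winner (stage E (Suc (k + n))) = c"
    and run: "\<And>j. j < n \<Longrightarrow> winner (stage E (Suc (k + j))) = (\<not> c)" and "n > 0"
  shows "full (Suc (k + n))"
proof -
  have const: "total (Suc j) = total j" if "k \<le> j" "j \<le> Suc (k + n)" for j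
    using stag total_mono[of k j] total_mono[of j "Suc j"] total_mono[of "Suc j" "Suc (Suc (k + n))"] that
    by linarith
  define \<pi> where "\<pi> = perm (stage E (Suc k)) (\<not> c)"
  define V where "V = visited E (Suc k) c"
  have w1: "winner (stage E (Suc k)) = (\<not> c)" using run[of 0] \<open>n > 0\<close> by simp
  \<comment> \<open>After stage \<open>k\<close>, won by \<open>c\<close>, the tower of the other
    letter starts with the floors of \<open>c\<close>. The opposite inclusion, twisted by
    \<open>\<pi>\<close>, is stagnation at the next stage, where the other letter wins.\<close>
  have 1: "visited E (Suc k) c s \<subseteq> visited E (Suc k) (\<not> c) s" if "s \<in> S" for s
    using visited_winner[of k s] visited_loser[of k s] unfolding c(1) by blast
  have 2: "visited E (Suc k) (\<not> c) s \<subseteq> visited E (Suc k) c (\<pi> s)" if "s \<in> S" for s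
    using total_Suc(2)[OF const[of "Suc k"] that] unfolding w1 \<pi>_def by simp
  have \<pi>: "\<pi> s \<in> S" if "s \<in> S" for s
    unfolding \<pi>_def by (rule perm_stage_in[OF that])
  have sumeq: "(\<Sum>s\<in>S. card (V (\<pi> s))) = (\<Sum>s\<in>S. card (V s))"
    unfolding \<pi>_def by (rule sum_perm)
  \<comment> \<open>The two inclusions put \<open>V s\<close> into \<open>V (\<pi> s)\<close>. As
    \<open>\<pi>\<close> permutes \<open>S\<close>, the cardinalities have equal sums, so every
    inclusion is an equality.\<close>
  have V\<pi>: "V s = V (\<pi> s)" if "s \<in> S" for s
  proof -
    have "card (V s) = card (V (\<pi> s))"
      using 1 2 finite_visited \<pi> unfolding V_def
      by (intro sum_mono_inv[OF sumeq[symmetric, unfolded V_def] _ that finite_S] card_mono) blast+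
    then show ?thesis
      using 1[OF that] 2[OF that] finite_visited[OF \<pi>[OF that]] unfolding V_def
      by (intro card_subset_eq) auto
  qed
  have V1: "visited E (Suc k) b s = V s" if "s \<in> S" for b s
    using 1[OF that] 2[OF that] V\<pi>[OF that] unfolding V_def by (cases "b = c") auto
  \<comment> \<open>The permutation of a letter does not change while that letter wins, so
    invariance under the single map \<open>\<pi>\<close> keeps all visited sets equal to
    \<open>V\<close> throughout the run.\<close>
  have inv: "(\<forall>b. \<forall>s\<in>S. visited E (Suc (k + j)) b s = V s) \<and>
      perm (stage E (Suc (k + j))) (\<not> c) = \<pi>" if "j \<le> n" for j
    using that
  proof (induction j)
    case 0
    then show ?case using V1 \<pi>_def by simp
  next
    case (Suc j)
    then have IH: "\<And>b s. s \<in> S \<Longrightarrow> visited E (Suc (k + j)) b s = V s"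
      "perm (stage E (Suc (k + j))) (\<not> c) = \<pi>" and w: "winner (stage E (Suc (k + j))) = (\<not> c)"
      using run[of j] by auto
    have "visited E (Suc (k + Suc j)) b s = V s" if "s \<in> S" for b s
      using visited_winner[of "Suc (k + j)" s] visited_loser[of "Suc (k + j)" s] IH that V\<pi>[OF that] \<pi>
      unfolding w by (cases "b = c") auto
    moreover have "perm (stage E (Suc (k + Suc j))) (\<not> c) = \<pi>"
      using IH(2) w by (simp add: perm_renorm len_renorm)
    ultimately show ?case by blast
  qed
  \<comment> \<open>Stagnation at the stage where \<open>c\<close> wins again supplies the
    invariance under the second permutation.\<close>
  have "V s \<subseteq> V (perm (stage E (Suc (k + n))) c s)" if "s \<in> S" for s
  proof -
    have "visited E (Suc (k + n)) c s \<subseteq> visited E (Suc (k + n)) (\<not> c) (perm (stage E (Suc (k + n))) c s)"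
      using total_Suc(2)[OF const[of "Suc (k + n)"] that] unfolding c(2) by simp
    then show ?thesis
      using inv[of n] that perm_stage_in[OF that, of "Suc (k + n)" c] by auto
  qed
  moreover have "V s \<subseteq> V (perm (stage E (Suc (k + n))) (\<not> c) s)" if "s \<in> S" for s
    using inv[of n] V\<pi>[OF that] by simp
  ultimately have "V s \<subseteq> V (perm (stage E (Suc (k + n))) b s)" if "s \<in> S" for b s
    using that by (cases "b = c") auto
  then show ?thesis
    using inv[of n] by (intro const_visited_full) auto
qed

text \<open>The winner has to change twice, each time within \<open>K + 1\<close> stages, and one
  more stage is used for the regained winner to act: this gives 2 K + 3.\<close>

lemma stagnation_window:
  assumes K: "\<rho> \<le> real K" and stag: "total (k + 2 * K + 3) = total k"
  shows "full (k + 2 * K + 3)"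
proof -
  define c where "c = winner (stage E k)"
  define m where "m = (LEAST j. winner (stage E (k + j)) \<noteq> c)"
  obtain j where j: "j \<le> Suc K" "winner (stage E (k + j)) \<noteq> c"
    using no_long_run[OF K, of k] unfolding c_def by blast
  have m: "winner (stage E (k + m)) \<noteq> c" "m \<le> Suc K"
    using LeastI[of "\<lambda>j. winner (stage E (k + j)) \<noteq> c", OF j(2)] Least_le[of "\<lambda>j. winner (stage E (k + j)) \<noteq> c", OF j(2)] j(1)
    unfolding m_def by auto
  have "m \<noteq> 0" using m(1) unfolding c_def by (metis add_0_right)
  \<comment> \<open>Stage \<open>k + m'\<close> is the last one of the first run, from which
    \<open>stagnation_full\<close> starts.\<close>
  then obtain m' where m': "m = Suc m'" using not0_implies_Suc by blast
  have km: "winner (stage E (k + m')) = c"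
    using not_less_Least[of m' "\<lambda>j. winner (stage E (k + j)) \<noteq> c"] m' unfolding m_def by simp
  define n where "n = (LEAST j. winner (stage E (k + m + j)) \<noteq> winner (stage E (k + m)))"
  obtain j where j: "j \<le> Suc K" "winner (stage E (k + m + j)) \<noteq> winner (stage E (k + m))"
    using no_long_run[OF K, of "k + m"] by blast
  have n: "winner (stage E (k + m + n)) \<noteq> winner (stage E (k + m))" "n \<le> Suc K"
    using LeastI[of "\<lambda>j. winner (stage E (k + m + j)) \<noteq> winner (stage E (k + m))", OF j(2)]
      Least_le[of "\<lambda>j. winner (stage E (k + m + j)) \<noteq> winner (stage E (k + m))", OF j(2)] j(1)
    unfolding n_def by auto
  have "n \<noteq> 0" using n(1) by (metis add_0_right)
  have run: "winner (stage E (k + m + j)) = (\<not> c)" if "j < n" for j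
    using not_less_Least[of j "\<lambda>j. winner (stage E (k + m + j)) \<noteq> winner (stage E (k + m))"] that m(1)
    unfolding n_def by auto
  have le: "Suc (Suc (k + m' + n)) \<le> k + 2 * K + 3"
    using m(2) n(2) m' by simp
  have "full (Suc (k + m' + n))"
  proof (rule stagnation_full)
    show "total (Suc (Suc (k + m' + n))) = total (k + m')"
      using stag total_mono[OF le] total_mono[of k "k + m'"] total_mono[of "k + m'" "Suc (Suc (k + m' + n))"]
      by linarith
    show "winner (stage E (k + m')) = c" by (rule km)
    show "winner (stage E (Suc (k + m' + n))) = c"
      using n(1) m(1) unfolding m' by simp
    show "winner (stage E (Suc (k + m' + j))) = (\<not> c)" if "j < n" for j
      using run[OF that] unfolding m' by simp
    show "n > 0" using \<open>n \<noteq> 0\<close> by simp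
  qed
  moreover have "Suc (k + m' + n) \<le> k + 2 * K + 3"
    using le by simp
  ultimately show ?thesis using full_mono by blast
qed

text \<open>Each window of length 2 K + 3 ends with full towers or raises the total by at least 1,
  and \<open>total_le\<close> limits the number of rises.\<close>

lemma eventually_full:
  assumes K: "\<rho> \<le> real K"
  shows "full (Suc (4 * card S * card S) * (2 * K + 3))"
proof -
  let ?L = "2 * K + 3"
  have "full (j * ?L) \<or> j \<le> total (j * ?L)" for j
  proof (induction j)
    case (Suc j)
    have s: "Suc j * ?L = j * ?L + 2 * K + 3" by simp
    show ?case
    proof (cases "full (j * ?L)")
      case True
      then have "full (Suc j * ?L)" by (rule full_mono[rotated]) simp
      then show ?thesis by blast
    next
      case False
      then have "j \<le> total (j * ?L)" using Suc by blast
      moreover have "full (Suc j * ?L) \<or> total (j * ?L) \<noteq> total (Suc j * ?L)"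
        using stagnation_window[OF K, of "j * ?L"] unfolding s by metis
      moreover have "total (j * ?L) \<le> total (Suc j * ?L)"
        by (rule total_mono) simp
      ultimately show ?thesis by linarith
    qed
  qed simp
  then show ?thesis
    using total_le by (metis not_less_eq_eq)
qed

text \<open>One summand \<open>2 ^ M\<close> is the time to reach stage \<open>M\<close>, at which
  all towers are full, the other the time to climb one tower. The bound involves only
  \<open>card S\<close> and \<open>K\<close>, so it serves every stage alike.\<close>

lemma visits_all:
  assumes K: "\<rho> \<le> real K" and "p \<in> states S E" "s \<in> S"
  shows "\<exists>j < 2 * 2 ^ (Suc (4 * card S * card S) * (2 * K + 3)).
    (step E ^^ j) p \<in> states S E \<and> fst ((step E ^^ j) p) = s \<and> letter E ((step E ^^ j) p) = b"
proof -
  define M where "M = Suc (4 * card S * card S) * (2 * K + 3)"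
  obtain i where i: "i \<le> max (height E M True) (height E M False)"
    "(step E ^^ i) p \<in> states S (stage E M)"
    using enters_stage[OF assms(2)] by blast
  let ?p = "(step E ^^ i) p"
  have "fst ?p \<in> S"
    using i(2) unfolding states_def by auto
  then have "(s, b) \<in> visited E M (letter (stage E M) ?p) (fst ?p)"
    using eventually_full[OF K] assms(3) unfolding M_def[symmetric] full_def by auto
  then obtain j where j: "j < height E M (letter (stage E M) ?p)"
    "(step E ^^ j) ?p \<in> states S E" "fst ((step E ^^ j) ?p) = s" "letter E ((step E ^^ j) ?p) = b"
    using visited_reached[OF i(2)] by blast
  have "i \<le> 2 ^ M" "j < 2 ^ M"
    using i(1) j(1) height_le[of M True] height_le[of M False] height_le[of M "letter (stage E M) ?p"]
    by linarith+
  then have "j + i < 2 * 2 ^ M" by linarith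
  then show ?thesis
    unfolding M_def[symmetric] using j(2-) by (intro exI[of _ "j + i"]) (simp add: funpow_add)
qed

end

text \<open>A return with letter \<open>b\<close> moves points by
  \<open>len (stage E k) (\<not> b)\<close> up to sign, and this shift is the sum of
  \<open>height E k b\<close> elementary ones. It is thus an integer combination of the two original
  lengths whose coefficients add up to the height, to which \<open>bad\<close> applies. The same
  bound excludes ties, which gives positivity at the next stage.\<close>

lemma stage_lengths:
  assumes pos: "\<And>b. 0 < len E b" and "c > 0"
    and bad: "\<And>i j :: nat. (i, j) \<noteq> (0, 0) \<Longrightarrow>
      c \<le> \<bar>real i * len E False - real j * len E True\<bar> * real (i + j)"
  shows "0 < len (stage E k) b \<and> c \<le> len (stage E k) (\<not> b) * real (height E k b)"
proof -
  have form: "\<exists>i j. i + j = height E k b \<and> 0 < len (stage E k) b \<and>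
      len (stage E k) (\<not> b) = (if b then real i * len E False - real j * len E True
        else real j * len E True - real i * len E False)" for b
  proof (induction k arbitrary: b)
    case 0
    then show ?case
      using pos by (cases b) (force intro: exI[of _ "1::nat"] exI[of _ "0::nat"])+
  next
    case (Suc k)
    let ?c = "winner (stage E k)"
    obtain i j where ij: "i + j = height E k ?c" "len (stage E k) (\<not> ?c) = (if ?c then real i * len E False - real j * len E True
        else real j * len E True - real i * len E False)" using Suc by blast
    obtain i' j' where ij': "i' + j' = height E k (\<not> ?c)" "len (stage E k) ?c = (if \<not> ?c then real i' * len E False - real j' * len E True
        else real j' * len E True - real i' * len E False)" using Suc[of "\<not> ?c"] by auto
    have len: "len (stage E (Suc k)) ?c = len (stage E k) ?c - len (stage E k) (\<not> ?c)"
      "len (stage E (Suc k)) (\<not> ?c) = len (stage E k) (\<not> ?c)"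
      by (simp_all add: perm_renorm len_renorm)
    have h: "height E (Suc k) ?c = i + j" "height E (Suc k) (\<not> ?c) = (i + i') + (j + j')"
      using ij(1) ij'(1) by (cases ?c; simp)+
    have lw: "len (stage E (Suc k)) ?c = (if \<not> ?c then real (i + i') * len E False - real (j + j') * len E True
        else real (j + j') * len E True - real (i + i') * len E False)"
      unfolding len ij(2) ij'(2) by (auto simp: algebra_simps)
    have "0 < len (stage E (Suc k)) ?c"
    proof -
      have "i + j > 0"
        unfolding ij(1) by (induction k) auto
      then have "c \<le> \<bar>real (i + i') * len E False - real (j + j') * len E True\<bar> * real (i + i' + (j + j'))"
        using bad[of "i + i'" "j + j'"] by auto
      then have "c \<le> \<bar>len (stage E (Suc k)) ?c\<bar> * real (i + i' + (j + j'))"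
        unfolding lw by (auto simp: abs_minus_commute)
      then have "len (stage E (Suc k)) ?c \<noteq> 0"
        using \<open>c > 0\<close> by auto
      moreover have "0 \<le> len (stage E (Suc k)) ?c"
        unfolding len by (cases ?c) (auto simp: winner_def)
      ultimately show ?thesis by linarith
    qed
    moreover have "0 < len (stage E (Suc k)) (\<not> ?c)"
      unfolding len using Suc by blast
    ultimately have pos': "0 < len (stage E (Suc k)) b" by (cases "b = ?c") auto
    show ?case
    proof (cases "b = ?c")
      case True
      have "i + j = height E (Suc k) b \<and> 0 < len (stage E (Suc k)) b \<and>
        len (stage E (Suc k)) (\<not> b) = (if b then real i * len E False - real j * len E True
        else real j * len E True - real i * len E False)"
        using h pos' len(2) ij(2) unfolding True by simp
      then show ?thesis by blast
    next
      case False
      then have b: "b = (\<not> ?c)" by auto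
      have "(i + i') + (j + j') = height E (Suc k) b \<and> 0 < len (stage E (Suc k)) b \<and>
        len (stage E (Suc k)) (\<not> b) = (if b then real (i + i') * len E False - real (j + j') * len E True
        else real (j + j') * len E True - real (i + i') * len E False)"
        using h pos' lw unfolding b by simp
      then show ?thesis by blast
    qed
  qed
  obtain i j where ij: "i + j = height E k b" "0 < len (stage E k) b"
    "len (stage E k) (\<not> b) = (if b then real i * len E False - real j * len E True
        else real j * len E True - real i * len E False)"
    using form by blast
  have "0 < len (stage E k) (\<not> b)" using form[of "\<not> b"] by blast
  have "0 < i + j" unfolding ij(1) by (induction k arbitrary: b) auto
  then have "c \<le> \<bar>len (stage E k) (\<not> b)\<bar> * real (i + j)"
    using bad[of i j] unfolding ij(3) by (auto simp: abs_minus_commute)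
  then show ?thesis
    using ij \<open>0 < len (stage E k) (\<not> b)\<close> by simp
qed

text \<open>The towers over the two base intervals fill the original interval: the loser's gain in
  height makes up for the winner's loss in length.\<close>

lemma total_area:
  "len (stage E k) True * real (height E k True) + len (stage E k) False * real (height E k False) =
     len E True + len E False"
proof (induction k)
  case (Suc k)
  then show ?case
    by (cases "winner (stage E k)") (simp_all add: len_renorm algebra_simps)
qed simp

lemma (in skew_exchange) iterate_stage:
  assumes "p \<in> states S (stage E k)" and H: "\<And>b. height E k b \<le> H"
  shows "(step (stage E k) ^^ j) p \<in> states S (stage E k) \<and>
    (\<exists>i \<le> j * H. (step E ^^ i) p = (step (stage E k) ^^ j) p)"
proof (induction j)
  case 0
  then show ?case using assms(1) by auto
next
  case (Suc j)
  interpret F: skew_exchange S "stage E k" \<rho>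
    by (rule skew_exchange_stage[OF skew_exchange_axioms])
  let ?q = "(step (stage E k) ^^ j) p"
  obtain i where i: "i \<le> j * H" "(step E ^^ i) p = ?q" and q: "?q \<in> states S (stage E k)"
    using Suc by blast
  let ?h = "height E k (letter (stage E k) ?q)"
  have "(step E ^^ (?h + i)) p = (step (stage E k) ^^ Suc j) p"
    using step_stage[OF q] i(2) by (simp add: funpow_add)
  moreover have "?h + i \<le> Suc j * H"
    using i(1) H[of "letter (stage E k) ?q"] by simp
  ultimately show ?case
    using F.step_states[OF q] by auto
qed

section \<open>Widths of the stages and density of orbits in linear time\<close>

context skew_exchange
begin

definition width :: "nat \<Rightarrow> real" where
  "width k = len (stage E k) True + len (stage E k) False"

lemma width_eq: "width k = len (stage E k) b + len (stage E k) (\<not> b)"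
  unfolding width_def by (cases b) auto

lemma len_ge_width: "width k \<le> (1 + \<rho>) * len (stage E k) b"
  using ratio[of k "\<not> b"] unfolding width_eq[of k b] by (simp add: algebra_simps)

lemma width_pos: "0 < width k"
  unfolding width_def using len_pos by (intro add_pos_pos)

lemma rho_pos: "0 < \<rho>"
  using ratio[of 0 True] len_pos[of 0 True] len_pos[of 0 False]
  by (simp add: zero_less_mult_iff) (smt (verit) mult_nonpos_nonneg)

text \<open>The next width is the winner's length: it is at least half of the width, being the
  longer part, and the loser takes away at least the fraction 1 / (1 + \<rho>).\<close>

lemma width_Suc:
  "width k / 2 \<le> width (Suc k)" "width (Suc k) \<le> \<rho> / (1 + \<rho>) * width k"
proof -
  let ?c = "winner (stage E k)"
  have w: "width (Suc k) = len (stage E k) ?c"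
    unfolding width_eq[of "Suc k" ?c] stage_winner_len by simp
  have "len (stage E k) (\<not> ?c) \<le> len (stage E k) ?c"
    using skew_exchange.len_loser_less[OF skew_exchange_stage[OF skew_exchange_axioms], of k] by simp
  then show "width k / 2 \<le> width (Suc k)"
    unfolding w width_eq[of k ?c] by simp
  have "width (Suc k) = width k - len (stage E k) (\<not> ?c)"
    unfolding w width_eq[of k ?c] by simp
  also have "\<dots> \<le> width k - width k / (1 + \<rho>)"
    using len_ge_width[of k "\<not> ?c"] rho_pos by (simp add: field_simps)
  also have "\<dots> = \<rho> / (1 + \<rho>) * width k"
    using rho_pos by (simp add: field_simps)
  finally show "width (Suc k) \<le> \<rho> / (1 + \<rho>) * width k" .
qed

lemma width_small:
  assumes "0 < e"
  shows "\<exists>k. width k \<le> e"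
proof -
  define r where "r = \<rho> / (1 + \<rho>)"
  have r: "0 \<le> r" "r < 1" using rho_pos unfolding r_def by (auto simp: field_simps)
  have le: "width k \<le> r ^ k * width 0" for k
  proof (induction k)
    case (Suc k)
    have "width (Suc k) \<le> r * width k" unfolding r_def by (rule width_Suc)
    also have "\<dots> \<le> r * (r ^ k * width 0)" using Suc r by (intro mult_left_mono)
    finally show ?case by (simp add: mult.assoc)
  qed simp
  obtain k where "r ^ k < e / width 0"
    using real_arch_pow_inv[of "e / width 0" r] r width_pos[of 0] assms by auto
  then have "r ^ k * width 0 \<le> e"
    using width_pos[of 0] by (simp add: field_simps)
  then show ?thesis using le[of k] by (meson order_trans)
qed

text \<open>The first stage of width at most 1 / n has width at least 1 / (2 n) unless it is stage
  0, and the area of a tower is at most \<open>width 0\<close>. The summand 1 covers stage 0, where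
  the height is 1.\<close>

lemma stage_of_scale:
  assumes "1 \<le> n"
  shows "\<exists>m. width m \<le> 1 / real n \<and> (\<forall>b. real (height E m b) \<le> (2 * width 0 * (1 + \<rho>) + 1) * real n)"
proof -
  define m where "m = (LEAST m. width m \<le> 1 / real n)"
  obtain k where k: "width k \<le> 1 / real n" using width_small[of "1 / real n"] assms by auto
  have m: "width m \<le> 1 / real n"
    unfolding m_def by (rule LeastI, rule k)
  have "real (height E m b) \<le> (2 * width 0 * (1 + \<rho>) + 1) * real n" for b
  proof (cases m)
    case 0
    have "1 * 1 \<le> (2 * width 0 * (1 + \<rho>) + 1) * real n"
      using width_pos[of 0] rho_pos assms by (intro mult_mono) auto
    then show ?thesis using 0 by simp
  next
    case (Suc m')
    have "1 / real n < width m'"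
      using not_less_Least[of m' "\<lambda>m. width m \<le> 1 / real n"] Suc unfolding m_def by simp
    then have w: "1 \<le> 2 * real n * width m"
    proof -
      have "1 < real n * width m'"
        using \<open>1 / real n < width m'\<close> assms by (simp add: field_simps)
      also have "\<dots> \<le> real n * (2 * width m)"
        using width_Suc(1)[of m'] Suc by (intro mult_left_mono) auto
      finally show ?thesis by simp
    qed
    have "len (stage E m) b * real (height E m b) \<le> width 0"
    proof -
      have "0 \<le> len (stage E m) b' * real (height E m b')" for b'
        using len_pos[of m b'] by simp
      from this[of True] this[of False] show ?thesis
        using total_area[where E = E and k = m] unfolding width_def by (cases b) auto
    qed
    then have "(1 + \<rho>) * (len (stage E m) b * real (height E m b)) \<le> (1 + \<rho>) * width 0"
      using rho_pos by (intro mult_left_mono) auto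
    then have "width m * real (height E m b) \<le> (1 + \<rho>) * width 0"
      using mult_right_mono[OF len_ge_width[of m b], of "real (height E m b)"]
      by (simp add: mult.assoc)
    then have "2 * real n * (width m * real (height E m b)) \<le> 2 * real n * ((1 + \<rho>) * width 0)"
      by (intro mult_left_mono) auto
    moreover have "1 * real (height E m b) \<le> (2 * real n * width m) * real (height E m b)"
      using w by (intro mult_right_mono) auto
    ultimately show ?thesis by (simp add: algebra_simps)
  qed
  then show ?thesis using m by blast
qed

text \<open>At the stage of width about 1 / n, one tower height suffices to enter, fewer than
  \<open>N\<close> returns lead to the base of the tower containing the target, and one more climb
  reaches its floor. As \<open>N\<close> does not depend on the stage, these \<open>N + 2\<close>
  heights are O(n) steps.\<close>

lemma orbits_superdense:
  "\<exists>C>0. \<forall>n\<ge>1. \<forall>p\<in>states S E. \<forall>q\<in>states S E. \<exists>j. real j \<le> C * real n \<and>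
     fst ((step E ^^ j) p) = fst q \<and> \<bar>snd ((step E ^^ j) p) - snd q\<bar> \<le> 1 / real n"
proof -
  define K where "K = nat \<lceil>\<rho>\<rceil>"
  have K: "\<rho> \<le> real K" unfolding K_def by linarith
  define N :: nat where "N = 2 * 2 ^ (Suc (4 * card S * card S) * (2 * K + 3))"
  define B where "B = 2 * width 0 * (1 + \<rho>) + 1"
  have B: "B > 0" unfolding B_def using width_pos[of 0] rho_pos
    by (intro add_nonneg_pos mult_nonneg_nonneg) auto
  have "\<exists>j. real j \<le> (real N + 2) * B * real n \<and>
     fst ((step E ^^ j) p) = fst q \<and> \<bar>snd ((step E ^^ j) p) - snd q\<bar> \<le> 1 / real n"
    if n: "1 \<le> n" and p: "p \<in> states S E" and q: "q \<in> states S E" for n p q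
  proof -
    obtain m where m: "width m \<le> 1 / real n" "\<And>b. real (height E m b) \<le> B * real n"
      using stage_of_scale[OF n] unfolding B_def by blast
    interpret F: skew_exchange S "stage E m" \<rho>
      by (rule skew_exchange_stage[OF skew_exchange_axioms])
    define H where "H = max (height E m True) (height E m False)"
    have H: "height E m b \<le> H" for b unfolding H_def by (cases b) auto
    have HB: "real H \<le> B * real n" unfolding H_def using m(2) by (auto simp: max_def)
    obtain i where i: "i \<le> H" "(step E ^^ i) p \<in> states S (stage E m)"
      using enters_stage[OF p] unfolding H_def by blast
    let ?p = "(step E ^^ i) p"
    obtain s t where st: "q = (s, t)" by force
    obtain s0 t0 where s0: "(s0, t0) \<in> states S (stage E m)"
      and reach: "\<And>u. (s0, u) \<in> states S (stage E m) \<Longrightarrow>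
        letter (stage E m) (s0, u) = letter (stage E m) (s0, t0) \<Longrightarrow>
        \<exists>j \<le> height E m (letter (stage E m) (s0, t0)). (step E ^^ j) (s0, u) = (s, t + (u - t0))"
      using tower_floor[of s t m] q unfolding st by blast
    have "s0 \<in> S" using s0 unfolding states_def by auto
    then obtain j where j: "j < N" "(step (stage E m) ^^ j) ?p \<in> states S (stage E m)"
      "fst ((step (stage E m) ^^ j) ?p) = s0"
      "letter (stage E m) ((step (stage E m) ^^ j) ?p) = letter (stage E m) (s0, t0)"
      using F.visits_all[OF K i(2)] unfolding N_def by blast
    obtain u where u: "(step (stage E m) ^^ j) ?p = (s0, u)"
      using j(3) by (metis prod.collapse)
    obtain l where l: "l \<le> H" "(step E ^^ l) (s0, u) = (s, t + (u - t0))"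
      using reach[of u] j u H order_trans by metis
    obtain k where k: "k \<le> j * H" "(step E ^^ k) ?p = (s0, u)"
      using iterate_stage[OF i(2) H, of j] u by auto
    have "(step E ^^ (l + (k + i))) p = (s, t + (u - t0))"
      using l k by (simp add: funpow_add)
    moreover have "\<bar>u - t0\<bar> \<le> 1 / real n"
      using j(2) s0 m(1) unfolding u states_def width_def by auto
    moreover have "real (l + (k + i)) \<le> (real N + 2) * B * real n"
    proof -
      have "j * H \<le> N * H" using j(1) by simp
      then have "l + (k + i) \<le> H + (N * H + H)"
        using l k i by linarith
      also have "\<dots> = (N + 2) * H" by simp
      finally have "real (l + (k + i)) \<le> (real N + 2) * real H"
        by (metis of_nat_add of_nat_le_iff of_nat_mult of_nat_numeral)
      also have "\<dots> \<le> (real N + 2) * (B * real n)"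
        using HB by (intro mult_left_mono) auto
      finally show ?thesis by (simp add: mult.assoc)
    qed
    ultimately show ?thesis
      unfolding st by (intro exI[of _ "l + (k + i)"]) simp
  qed
  then show ?thesis
    using B by (intro exI[of _ "(real N + 2) * B"]) auto
qed

end

text \<open>Eliminating the height of letter b from c <= len (not b) * height b and the area bound
  len b * height b <= len True + len False yields the stated ratio.\<close>

lemma skew_exchangeI:
  assumes "finite S" "\<And>b. bij_betw (perm E b) S S"
    and "\<And>A. \<lbrakk>A \<subseteq> S; A \<noteq> {}; \<And>b. perm E b ` A \<subseteq> A\<rbrakk> \<Longrightarrow> A = S"
    and pos: "\<And>b. 0 < len E b" and "c > 0"
    and bad: "\<And>i j :: nat. (i, j) \<noteq> (0, 0) \<Longrightarrow>
      c \<le> \<bar>real i * len E False - real j * len E True\<bar> * real (i + j)"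
  shows "skew_exchange S E ((len E True + len E False) / c)"
proof
  fix k b
  note lengths = stage_lengths[where E = E, OF pos \<open>c > 0\<close> bad, of k]
  show "0 < len (stage E k) b" using lengths by blast
  have "0 \<le> len (stage E k) b' * real (height E k b')" for b'
    using lengths[of b'] by simp
  from this[of True] this[of False]
  have area: "len (stage E k) b * real (height E k b) \<le> len E True + len E False"
    using total_area[where E = E and k = k] by (cases b) auto
  have "len (stage E k) b * c \<le> len (stage E k) b * (len (stage E k) (\<not> b) * real (height E k b))"
    using lengths[of b] by (intro mult_left_mono) auto
  also have "\<dots> = len (stage E k) (\<not> b) * (len (stage E k) b * real (height E k b))"
    by simp
  also have "\<dots> \<le> len (stage E k) (\<not> b) * (len E True + len E False)"
    using area lengths[of "\<not> b"] by (intro mult_left_mono) auto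
  finally show "len (stage E k) b \<le> (len E True + len E False) / c * len (stage E k) (\<not> b)"
    using \<open>c > 0\<close> by (simp add: field_simps)
qed (use assms in blast)+

section \<open>The glued surface\<close>


lemma mem_right_edge: "z \<in> right_edge s \<longleftrightarrow> (\<exists>y. 0 \<le> y \<and> y \<le> 1 \<and> z = s + (1, y))"
proof -
  have "(1 - y) *\<^sub>R (s + (1, 0)) + y *\<^sub>R (s + (1, 1)) = s + (1, y)" for y :: real
    by (cases s) (simp add: algebra_simps)
  then show ?thesis by (simp add: right_edge_def in_segment)
qed

lemma mem_top_edge: "z \<in> top_edge s \<longleftrightarrow> (\<exists>x. 0 \<le> x \<and> x \<le> 1 \<and> z = s + (x, 1))"
proof -
  have "(1 - x) *\<^sub>R (s + (0, 1)) + x *\<^sub>R (s + (1, 1)) = s + (x, 1)" for x :: real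
    by (cases s) (simp add: algebra_simps)
  then show ?thesis by (simp add: top_edge_def in_segment)
qed

lemma mem_atomic: "s + (x, y) \<in> atomic s \<longleftrightarrow> 0 \<le> x \<and> x \<le> 1 \<and> 0 \<le> y \<and> y \<le> 1"
  by (cases s) (auto simp: atomic_def cbox_Pair_eq)

text \<open>With coordinates relative to the lower left corner, an elementary gluing replaces 1 by 0
  in one coordinate and preserves the other.\<close>

definition loc :: "real \<times> real \<Rightarrow> real \<Rightarrow> real \<Rightarrow> point" where
  "loc s x y = (s, s + (x, y))"

lemma loc_eq_iff [simp]: "loc s x y = loc s' x' y' \<longleftrightarrow> s = s' \<and> x = x' \<and> y = y'"
  by (auto simp: loc_def)

lemma edge_glue_right:
  assumes "s \<in> squares P" "0 \<le> y" "y \<le> 1"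
  shows "(loc s 1 y, loc (right_nb P s) 0 y) \<in> edge_glue P"
proof -
  have "right_nb P s + (0, y) = s + (1, y) + (right_nb P s - (s + (1, 0)))"
    by (cases s; cases "right_nb P s") simp
  then show ?thesis
    unfolding edge_glue_def loc_def using assms mem_right_edge by blast
qed

lemma edge_glue_top:
  assumes "s \<in> squares P" "0 \<le> x" "x \<le> 1"
  shows "(loc s x 1, loc (top_nb P s) x 0) \<in> edge_glue P"
proof -
  have "top_nb P s + (x, 0) = s + (x, 1) + (top_nb P s - (s + (0, 1)))"
    by (cases s; cases "top_nb P s") simp
  then show ?thesis
    unfolding edge_glue_def loc_def using assms mem_top_edge by blast
qed

lemma edge_glueE:
  assumes "(p, q) \<in> edge_glue P"
  obtains (right) s y where "s \<in> squares P" "0 \<le> y" "y \<le> 1"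
      "p = loc s 1 y" "q = loc (right_nb P s) 0 y"
    | (top) s x where "s \<in> squares P" "0 \<le> x" "x \<le> 1"
      "p = loc s x 1" "q = loc (top_nb P s) x 0"
proof -
  from assms consider
    (R) s z where "p = (s, z)" "q = (right_nb P s, z + (right_nb P s - (s + (1, 0))))"
      "s \<in> squares P" "z \<in> right_edge s"
    | (T) s z where "p = (s, z)" "q = (top_nb P s, z + (top_nb P s - (s + (0, 1))))"
      "s \<in> squares P" "z \<in> top_edge s"
    unfolding edge_glue_def by blast
  then show thesis
  proof cases
    case R
    then obtain y where "0 \<le> y" "y \<le> 1" "z = s + (1, y)" using mem_right_edge by blast
    moreover have "s + (1, y) + (right_nb P s - (s + (1, 0))) = right_nb P s + (0, y)" for y
      by (cases s; cases "right_nb P s") simp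
    ultimately show ?thesis using right[of s y] R by (simp add: loc_def)
  next
    case T
    then obtain x where "0 \<le> x" "x \<le> 1" "z = s + (x, 1)" using mem_top_edge by blast
    moreover have "s + (x, 1) + (top_nb P s - (s + (0, 1))) = top_nb P s + (x, 0)" for x
      by (cases s; cases "top_nb P s") simp
    ultimately show ?thesis using top[of s x] T by (simp add: loc_def)
  qed
qed

lemmas edge_defs = right_edge_def left_edge_def top_edge_def bottom_edge_def closed_segment_eq doubleton_eq_iff

lemma edge_same:
  "right_edge s = right_edge q \<Longrightarrow> s = q" "left_edge s = left_edge q \<Longrightarrow> s = q"
  "top_edge s = top_edge q \<Longrightarrow> s = q" "bottom_edge s = bottom_edge q \<Longrightarrow> s = q"
  unfolding edge_defs by (cases s; cases q; force)+

lemma edge_differ: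
  "right_edge s \<noteq> top_edge q" "right_edge s \<noteq> bottom_edge q"
  "left_edge s \<noteq> top_edge q" "left_edge s \<noteq> bottom_edge q"
  unfolding edge_defs by (cases s; cases q; force)+

locale flat_surface =
  fixes P :: surface
  assumes surface: "polysquare_surface P"
begin

lemma finite_squares: "finite (squares P)" and squares_nonempty: "squares P \<noteq> {}"
  using surface unfolding polysquare_surface_def polysquare_region_def by auto

lemma bij_right: "bij_betw (right_nb P) (squares P) (squares P)"
  and bij_top: "bij_betw (top_nb P) (squares P) (squares P)"
  using surface unfolding polysquare_surface_def by auto

lemma nb_in: "s \<in> squares P \<Longrightarrow> right_nb P s \<in> squares P" "s \<in> squares P \<Longrightarrow> top_nb P s \<in> squares P"
  using bij_right bij_top bij_betwE by blast+

lemma nb_inj: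
  "\<lbrakk>s \<in> squares P; q \<in> squares P; right_nb P s = right_nb P q\<rbrakk> \<Longrightarrow> s = q"
  "\<lbrakk>s \<in> squares P; q \<in> squares P; top_nb P s = top_nb P q\<rbrakk> \<Longrightarrow> s = q"
  using bij_right bij_top unfolding bij_betw_def inj_on_def by blast+

lemma nb_surj:
  "s \<in> squares P \<Longrightarrow> \<exists>q\<in>squares P. right_nb P q = s"
  "s \<in> squares P \<Longrightarrow> \<exists>q\<in>squares P. top_nb P q = s"
  using bij_right bij_top unfolding bij_betw_def by (metis imageE)+

text \<open>Distinct squares with a common edge have it on opposite sides, and a common edge that is
  not a wall is glued to itself.\<close>

lemma neighbours_cases:
  assumes "(s, q) \<in> neighbours P"
  shows "q = right_nb P s \<or> q = top_nb P s \<or> s = right_nb P q \<or> s = top_nb P q"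
proof -
  obtain e where sq: "s \<in> squares P" "q \<in> squares P" "s \<noteq> q"
    and e: "e \<in> edges s" "e \<in> edges q" "e \<notin> walls P"
    using assms unfolding neighbours_def by auto
  have R: "right_nb P s' = q'" if "s' \<in> squares P" "q' \<in> squares P" "right_edge s' = left_edge q'"
    "right_edge s' \<notin> walls P" for s' q'
    using surface that unfolding polysquare_surface_def by blast
  have T: "top_nb P s' = q'" if "s' \<in> squares P" "q' \<in> squares P" "top_edge s' = bottom_edge q'"
    "top_edge s' \<notin> walls P" for s' q'
    using surface that unfolding polysquare_surface_def by blast
  have coincide: "(e = right_edge s \<and> e = left_edge q) \<or> (e = left_edge s \<and> e = right_edge q) \<or>
      (e = top_edge s \<and> e = bottom_edge q) \<or> (e = bottom_edge s \<and> e = top_edge q)"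
    using e(1,2) sq(3) edge_same[of s q] edge_differ[of s q] edge_differ[of q s]
    unfolding edges_def insert_iff empty_iff by metis
  then show ?thesis
    using R[OF sq(1,2)] R[OF sq(2,1)] T[OF sq(1,2)] T[OF sq(2,1)] e(3) by (elim disjE conjE) simp_all
qed

text \<open>On a finite invariant set the injections \<open>right_nb\<close> and
  \<open>top_nb\<close> are onto, so the set is closed under their inverses too, and hence under
  passing to neighbours.\<close>

lemma squares_connected:
  assumes A: "A \<subseteq> squares P" "A \<noteq> {}" and "right_nb P ` A \<subseteq> A" "top_nb P ` A \<subseteq> A"
  shows "A = squares P"
proof -
  have fin: "finite A" using A(1) finite_squares by (rule finite_subset)
  have "inj_on (right_nb P) A" "inj_on (top_nb P) A"
    using bij_right bij_top A(1) unfolding bij_betw_def by (blast intro: inj_on_subset)+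
  then have img: "right_nb P ` A = A" "top_nb P ` A = A"
    using endo_inj_surj[OF fin assms(3)] endo_inj_surj[OF fin assms(4)] by blast+
  have closed: "q \<in> A" if "(s, q) \<in> neighbours P" "s \<in> A" for s q
  proof -
    have q: "q \<in> squares P" using that(1) unfolding neighbours_def by auto
    note sA = that(2)
    from neighbours_cases[OF that(1)] show ?thesis
    proof (elim disjE)
      assume "s = right_nb P q"
      then have "right_nb P q \<in> right_nb P ` A" using img(1) sA by simp
      then obtain q' where "right_nb P q = right_nb P q'" "q' \<in> A" by (rule imageE)
      then show ?thesis using nb_inj(1)[OF q, of q'] A(1) by auto
    next
      assume "s = top_nb P q"
      then have "top_nb P q \<in> top_nb P ` A" using img(2) sA by simp
      then obtain q' where "top_nb P q = top_nb P q'" "q' \<in> A" by (rule imageE)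
      then show ?thesis using nb_inj(2)[OF q, of q'] A(1) by auto
    qed (use assms(3,4) sA in auto)
  qed
  obtain s where s: "s \<in> A" using A(2) by blast
  have "q \<in> A" if "q \<in> squares P" for q
  proof -
    have "(s, q) \<in> (neighbours P)\<^sup>*"
      using surface s A(1) that unfolding polysquare_surface_def polysquare_region_def by blast
    then show ?thesis
      by (induction rule: rtrancl_induct) (use s closed in blast)+
  qed
  then show ?thesis using A(1) by blast
qed

lemma square_points_iff:
  "loc s x y \<in> square_points P \<longleftrightarrow> s \<in> squares P \<and> 0 \<le> x \<and> x \<le> 1 \<and> 0 \<le> y \<and> y \<le> 1"
  by (auto simp: square_points_def mem_atomic loc_def)

lemma square_points_cases:
  assumes "p \<in> square_points P"
  obtains s x y where "s \<in> squares P" "0 \<le> x" "x \<le> 1" "0 \<le> y" "y \<le> 1" "p = loc s x y"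
proof -
  obtain s z where p: "p = (s, z)" by (cases p)
  have z: "z = s + (fst z - fst s, snd z - snd s)"
    by (cases s; cases z) simp
  then have "p = loc s (fst z - fst s) (snd z - snd s)"
    unfolding p loc_def by simp
  then show ?thesis
    using that assms square_points_iff by metis
qed

section \<open>Equivalence classes of the gluing away from the corners\<close>

lemma glue_refl: "p \<in> square_points P \<Longrightarrow> (p, p) \<in> glue P"
  by (simp add: glue_def)

lemma glue_sym: "(p, q) \<in> glue P \<Longrightarrow> (q, p) \<in> glue P"
proof -
  have "sym ((edge_glue P \<union> (edge_glue P)\<inverse>)\<^sup>*)"
    by (intro sym_rtrancl) (auto simp: sym_def)
  then show "(p, q) \<in> glue P \<Longrightarrow> (q, p) \<in> glue P"
    unfolding glue_def by (blast dest: symD)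
qed

lemma glue_trans: "\<lbrakk>(p, q) \<in> glue P; (q, r) \<in> glue P\<rbrakk> \<Longrightarrow> (p, r) \<in> glue P"
  unfolding glue_def by (blast intro: rtrancl_trans)

lemma surface_point_eq_iff:
  assumes "p \<in> square_points P" "q \<in> square_points P"
  shows "surface_point P p = surface_point P q \<longleftrightarrow> (p, q) \<in> glue P"
  using assms glue_refl glue_sym glue_trans unfolding surface_point_def by blast

lemma glue_right: "\<lbrakk>s \<in> squares P; 0 \<le> y; y \<le> 1\<rbrakk> \<Longrightarrow>
    (loc s 1 y, loc (right_nb P s) 0 y) \<in> glue P"
  unfolding glue_def using edge_glue_right[of s P y] nb_in(1)[of s]
  by (intro IntI r_into_rtrancl) (simp_all add: square_points_iff)

lemma glue_top: "\<lbrakk>s \<in> squares P; 0 \<le> x; x \<le> 1\<rbrakk> \<Longrightarrow>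
    (loc s x 1, loc (top_nb P s) x 0) \<in> glue P"
  unfolding glue_def using edge_glue_top[of s P x] nb_in(2)[of s]
  by (intro IntI r_into_rtrancl) (simp_all add: square_points_iff)

text \<open>The means of computing a class: guess a set containing it and check single edge gluings
  in both directions.\<close>

lemma glue_closed:
  assumes "(p, q) \<in> glue P" "p \<in> C"
    and "\<And>x y. \<lbrakk>x \<in> C; (x, y) \<in> edge_glue P \<or> (y, x) \<in> edge_glue P\<rbrakk> \<Longrightarrow> y \<in> C"
  shows "q \<in> C"
proof -
  have "(p, q) \<in> (edge_glue P \<union> (edge_glue P)\<inverse>)\<^sup>*"
    using assms(1) unfolding glue_def by blast
  then show ?thesis
    by (induction rule: rtrancl_induct) (use assms(2,3) in auto)
qed

lemma glue_interior:
  assumes "(loc s x y, q) \<in> glue P" "0 < x" "x < 1" "0 < y" "y < 1"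
  shows "q = loc s x y"
proof -
  have "q \<in> {loc s x y}"
  proof (rule glue_closed[OF assms(1)])
    fix p q assume "p \<in> {loc s x y}" and e: "(p, q) \<in> edge_glue P \<or> (q, p) \<in> edge_glue P"
    then have p: "p = loc s x y" by simp
    from e show "q \<in> {loc s x y}"
      by (elim disjE; elim edge_glueE) (use assms(2-) in \<open>simp_all add: p\<close>)
  qed simp
  then show ?thesis by simp
qed

lemma glue_right_edge:
  assumes g: "(p, q) \<in> glue P" and p: "p = loc s 1 y \<or> p = loc (right_nb P s) 0 y"
    and s: "s \<in> squares P" and y: "0 < y" "y < 1"
  shows "q = loc s 1 y \<or> q = loc (right_nb P s) 0 y"
proof -
  let ?C = "{loc s 1 y, loc (right_nb P s) 0 y}"
  have "q \<in> ?C"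
  proof (rule glue_closed[OF g])
    fix p q assume p: "p \<in> ?C" and e: "(p, q) \<in> edge_glue P \<or> (q, p) \<in> edge_glue P"
    from e show "q \<in> ?C"
    proof
      assume "(p, q) \<in> edge_glue P"
      then show ?thesis by (rule edge_glueE) (use p y in simp_all)
    next
      assume "(q, p) \<in> edge_glue P"
      then show ?thesis
      proof (rule edge_glueE)
        fix s' y' assume s': "s' \<in> squares P" "q = loc s' 1 y'" "p = loc (right_nb P s') 0 y'"
        then have "right_nb P s = right_nb P s'" "y' = y" using p by simp_all
        then show ?thesis using s' nb_inj(1)[OF s s'(1)] by simp
      qed (use p y in auto)
    qed
  qed (use p in auto)
  then show ?thesis by simp
qed

lemma glue_top_edge:
  assumes g: "(p, q) \<in> glue P" and p: "p = loc s x 1 \<or> p = loc (top_nb P s) x 0"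
    and s: "s \<in> squares P" and x: "0 < x" "x < 1"
  shows "q = loc s x 1 \<or> q = loc (top_nb P s) x 0"
proof -
  let ?C = "{loc s x 1, loc (top_nb P s) x 0}"
  have "q \<in> ?C"
  proof (rule glue_closed[OF g])
    fix p q assume p: "p \<in> ?C" and e: "(p, q) \<in> edge_glue P \<or> (q, p) \<in> edge_glue P"
    from e show "q \<in> ?C"
    proof
      assume "(p, q) \<in> edge_glue P"
      then show ?thesis by (rule edge_glueE) (use p x in simp_all)
    next
      assume "(q, p) \<in> edge_glue P"
      then show ?thesis
      proof (rule edge_glueE)
        fix s' x' assume s': "s' \<in> squares P" "q = loc s' x' 1" "p = loc (top_nb P s') x' 0"
        then have "top_nb P s = top_nb P s'" "x' = x" using p by simp_all
        then show ?thesis using s' nb_inj(2)[OF s s'(1)] by simp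
      qed (use p x in auto)
    qed
  qed (use p in auto)
  then show ?thesis by simp
qed

text \<open>The interior and edge cases merged into a form that does not distinguish left from right
  or top from bottom, as the reflections by \<open>orient\<close> require.\<close>

lemma glue_not_corner:
  assumes g: "(loc s x y, q) \<in> glue P" and nc: "\<not> (x \<in> {0, 1} \<and> y \<in> {0, 1})"
  shows "q = loc s x y \<or> (x \<in> {0, 1} \<and> (\<exists>s'. q = loc s' (1 - x) y)) \<or>
    (y \<in> {0, 1} \<and> (\<exists>s'. q = loc s' x (1 - y)))"
proof -
  have xy: "s \<in> squares P" "0 \<le> x" "x \<le> 1" "0 \<le> y" "y \<le> 1"
    using g unfolding glue_def by (auto simp: square_points_iff)
  consider "0 < x" "x < 1" "0 < y" "y < 1" | "x = 1" "0 < y" "y < 1" | "x = 0" "0 < y" "y < 1"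
    | "y = 1" "0 < x" "x < 1" | "y = 0" "0 < x" "x < 1"
    using xy nc by (cases "x = 0"; cases "x = 1"; cases "y = 0"; cases "y = 1") simp_all
  then show ?thesis
  proof cases
    case 1
    then show ?thesis using glue_interior[OF g] by blast
  next
    case 2
    then have "q = loc s 1 y \<or> q = loc (right_nb P s) 0 y"
      using glue_right_edge[OF g _ xy(1) 2(2,3)] by simp
    then show ?thesis using 2(1) by auto
  next
    case 3
    obtain s0 where "s0 \<in> squares P" "right_nb P s0 = s" using nb_surj(1)[OF xy(1)] by blast
    then have "q = loc s0 1 y \<or> q = loc s 0 y"
      using glue_right_edge[OF g _ _ 3(2,3), of s0] 3(1) by simp
    then show ?thesis using 3(1) by auto
  next
    case 4
    then have "q = loc s x 1 \<or> q = loc (top_nb P s) x 0"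
      using glue_top_edge[OF g _ xy(1) 4(2,3)] by simp
    then show ?thesis using 4(1) by auto
  next
    case 5
    obtain s0 where "s0 \<in> squares P" "top_nb P s0 = s" using nb_surj(2)[OF xy(1)] by blast
    then have "q = loc s0 x 1 \<or> q = loc s x 0"
      using glue_top_edge[OF g _ _ 5(2,3), of s0] 5(1) by simp
    then show ?thesis using 5(1) by auto
  qed
qed

section \<open>Upper bounds for the flat distance\<close>

lemma broken_line_nonneg: "broken_line P p q l \<Longrightarrow> 0 \<le> l"
  by (induction rule: broken_line.induct) auto

lemma flat_dist_le:
  assumes "p \<in> X" "q \<in> Y" "broken_line P p q l"
  shows "flat_dist P X Y \<le> l"
  unfolding flat_dist_def
  by (rule cInf_lower) (use assms in \<open>auto intro!: bdd_belowI[of _ 0] dest: broken_line_nonneg\<close>)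

lemma flat_dist_square:
  assumes "s \<in> squares P" "0 \<le> x" "x \<le> 1" "0 \<le> y" "y \<le> 1" "0 \<le> x'" "x' \<le> 1" "0 \<le> y'" "y' \<le> 1"
  shows "flat_dist P (surface_point P (loc s x y)) (surface_point P (loc s x' y')) \<le> \<bar>x - x'\<bar> + \<bar>y - y'\<bar>"
proof -
  have "broken_line P (loc s x y) (loc s x' y') (dist (s + (x, y)) (s + (x', y')))"
    unfolding loc_def using assms by (intro broken_line.segment) (simp_all add: mem_atomic)
  moreover have "loc s x y \<in> surface_point P (loc s x y)" "loc s x' y' \<in> surface_point P (loc s x' y')"
    using assms by (simp_all add: surface_point_def square_points_iff glue_refl)
  ultimately have "flat_dist P (surface_point P (loc s x y)) (surface_point P (loc s x' y'))
      \<le> dist (s + (x, y)) (s + (x', y'))"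
    by (intro flat_dist_le)
  also have "\<dots> = dist (x, y) (x', y')" by (simp add: dist_norm)
  also have "\<dots> \<le> \<bar>x - x'\<bar> + \<bar>y - y'\<bar>"
    by (simp add: dist_Pair_Pair dist_real_def sqrt_sum_squares_le_sum_abs)
  finally show ?thesis .
qed

end

section \<open>The cutting sequence of a geodesic\<close>


text \<open>The supremum of the initial segments on which \<open>Q\<close> holds is itself good by
  \<open>left\<close> and cannot lie below \<open>b\<close> by \<open>right\<close>. This extends
  the local straightness of a geodesic to whole time intervals.\<close>

lemma real_induction [consumes 1, case_names base right left]:
  fixes a b :: real
  assumes "a \<le> b" and base: "Q a"
    and right: "\<And>x. \<lbrakk>a \<le> x; x < b; Q x\<rbrakk> \<Longrightarrow> \<exists>z>x. \<forall>y. x \<le> y \<and> y \<le> z \<and> y \<le> b \<longrightarrow> Q y"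
    and left: "\<And>x. \<lbrakk>a < x; x \<le> b; \<And>y. \<lbrakk>a \<le> y; y < x\<rbrakk> \<Longrightarrow> Q y\<rbrakk> \<Longrightarrow> Q x"
  shows "Q b"
proof -
  define M where "M = {x. a \<le> x \<and> x \<le> b \<and> (\<forall>y. a \<le> y \<and> y \<le> x \<longrightarrow> Q y)}"
  define x where "x = Sup M"
  have "a \<in> M" using assms(1) base unfolding M_def by auto
  have bdd: "bdd_above M" unfolding M_def by (intro bdd_aboveI[of _ b]) auto
  have ax: "a \<le> x" unfolding x_def by (rule cSup_upper[OF \<open>a \<in> M\<close> bdd])
  have xb: "x \<le> b" unfolding x_def using \<open>a \<in> M\<close> by (intro cSup_least) (auto simp: M_def)
  have below: "Q y" if "a \<le> y" "y < x" for y
  proof -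
    obtain m where "m \<in> M" "y < m"
      using \<open>y < x\<close> \<open>a \<in> M\<close> bdd unfolding x_def by (subst (asm) less_cSup_iff) auto
    then show ?thesis using that(1) unfolding M_def by auto
  qed
  have "Q x"
  proof (cases "x = a")
    case False
    show ?thesis
    proof (rule left)
      show "a < x" using ax False by simp
    qed (use xb below in auto)
  qed (use base in simp)
  show ?thesis
  proof (cases "x = b")
    case False
    then have "x < b" using xb by simp
    then obtain z where z: "z > x" "\<And>y. x \<le> y \<Longrightarrow> y \<le> z \<Longrightarrow> y \<le> b \<Longrightarrow> Q y"
      using right[OF ax _ \<open>Q x\<close>] by blast
    have "min z b \<in> M"
    proof -
      have "Q y" if "a \<le> y" "y \<le> min z b" for y
        using that below[of y] z(2)[of y] by (cases "y < x") auto
      then show ?thesis unfolding M_def using ax \<open>x < b\<close> z(1) by auto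
    qed
    then have "min z b \<le> x"
      unfolding x_def using bdd by (rule cSup_upper)
    then show ?thesis using z(1) \<open>x < b\<close> by simp
  qed (use \<open>Q x\<close> in simp)
qed

text \<open>Coordinates are reflected where \<open>v\<close> points to the left or downwards, so that
  the flow always increases both of them.\<close>

definition orient :: "real \<Rightarrow> real \<Rightarrow> real" where
  "orient d x = (if 0 < d then x else 1 - x)"

lemma orient_orient [simp]: "orient d (orient d x) = x"
  by (simp add: orient_def)

lemma orient_le: "0 \<le> orient d x \<and> orient d x \<le> 1 \<longleftrightarrow> 0 \<le> x \<and> x \<le> 1"
  by (auto simp: orient_def)

lemma orient_add: "d \<noteq> 0 \<Longrightarrow> orient d (x + \<bar>d\<bar> * t) = orient d x + t * d"
  by (auto simp: orient_def abs_if algebra_simps)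

locale oriented_surface = flat_surface +
  fixes v :: "real \<times> real"
  assumes slopes: "fst v \<noteq> 0" "snd v \<noteq> 0"
begin

abbreviation A where "A \<equiv> \<bar>fst v\<bar>"
abbreviation B where "B \<equiv> \<bar>snd v\<bar>"

lemma AB_pos: "0 < A" "0 < B"
  using slopes by auto

definition pt :: "real \<times> real \<Rightarrow> real \<Rightarrow> real \<Rightarrow> point set" where
  "pt s X Y = surface_point P (loc s (orient (fst v) X) (orient (snd v) Y))"

definition ahead :: "real \<times> real \<Rightarrow> real \<times> real" where
  "ahead = (if 0 < fst v then right_nb P else inv_into (squares P) (right_nb P))"

definition above :: "real \<times> real \<Rightarrow> real \<times> real" where
  "above = (if 0 < snd v then top_nb P else inv_into (squares P) (top_nb P))"

text \<open>The fibre is the current square, and the base coordinate is B X - A Y, constant along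
  the flow in a square. It runs from -A at the upper left corner to B at the lower right one; the
  value B - A at the upper right corner separates exits through the top (\<open>True\<close>) from
  exits through the side (\<open>False\<close>), all in reflected coordinates.\<close>

definition crossing :: "(real \<times> real) exchange" where
  "crossing = \<lparr>perm = (\<lambda>b. if b then above else ahead), len = (\<lambda>b. if b then B else A)\<rparr>"

lemma bij_ahead: "bij_betw ahead (squares P) (squares P)"
  using bij_right bij_betw_inv_into unfolding ahead_def by auto

lemma bij_above: "bij_betw above (squares P) (squares P)"
  using bij_top bij_betw_inv_into unfolding above_def by auto

lemma ahead_in: "s \<in> squares P \<Longrightarrow> ahead s \<in> squares P"
  and above_in: "s \<in> squares P \<Longrightarrow> above s \<in> squares P"
  using bij_ahead bij_above bij_betwE by blast+

text \<open>A finite set of squares invariant under the inverse of a bijection is invariant under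
  the bijection, so reflecting a coordinate preserves transitivity.\<close>

lemma crossing_transitive:
  assumes "M \<subseteq> squares P" "M \<noteq> {}" "ahead ` M \<subseteq> M" "above ` M \<subseteq> M"
  shows "M = squares P"
proof (rule squares_connected[OF assms(1,2)])
  have fin: "finite M" using assms(1) finite_squares by (rule finite_subset)
  have reverse: "f ` M \<subseteq> M" if f: "bij_betw f (squares P) (squares P)"
    and inv: "inv_into (squares P) f ` M \<subseteq> M" for f
  proof -
    have "inj_on (inv_into (squares P) f) M"
      using bij_betw_inv_into[OF f] assms(1) unfolding bij_betw_def by (blast intro: inj_on_subset)
    then have "inv_into (squares P) f ` M = M"
      by (rule endo_inj_surj[OF fin inv])
    moreover have "f ` inv_into (squares P) f ` M = M"
      by (rule image_inv_into_cancel[OF bij_betw_imp_surj_on[OF f] assms(1)])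
    ultimately show ?thesis by (metis subset_refl)
  qed
  show "right_nb P ` M \<subseteq> M"
    using assms(3) reverse[OF bij_right] by (cases "0 < fst v") (simp_all add: ahead_def)
  show "top_nb P ` M \<subseteq> M"
    using assms(4) reverse[OF bij_top] by (cases "0 < snd v") (simp_all add: above_def)
qed

lemma loc_in_square_points:
  "\<lbrakk>s \<in> squares P; 0 \<le> X; X \<le> 1; 0 \<le> Y; Y \<le> 1\<rbrakk> \<Longrightarrow>
    loc s (orient d X) (orient e Y) \<in> square_points P"
  using orient_le[of d X] orient_le[of e Y] by (simp add: square_points_iff)

lemma pt_ahead:
  assumes s: "s \<in> squares P" and Y: "0 \<le> Y" "Y \<le> 1"
  shows "pt s 1 Y = pt (ahead s) 0 Y"
proof -
  have Y': "0 \<le> orient (snd v) Y" "orient (snd v) Y \<le> 1" using Y orient_le by auto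
  have "(loc s (orient (fst v) 1) (orient (snd v) Y),
      loc (ahead s) (orient (fst v) 0) (orient (snd v) Y)) \<in> glue P"
  proof (cases "0 < fst v")
    case True
    then show ?thesis using glue_right[OF s Y'] by (simp add: ahead_def orient_def)
  next
    case False
    then have "right_nb P (ahead s) = s"
      using s bij_right unfolding ahead_def bij_betw_def by (simp add: f_inv_into_f)
    then show ?thesis
      using False glue_sym[OF glue_right[OF ahead_in[OF s] Y']] by (simp add: orient_def[of "fst v"])
  qed
  then show ?thesis
    unfolding pt_def using s ahead_in[OF s] Y
    by (subst surface_point_eq_iff) (auto intro: loc_in_square_points)
qed

lemma pt_above:
  assumes s: "s \<in> squares P" and X: "0 \<le> X" "X \<le> 1"
  shows "pt s X 1 = pt (above s) X 0"
proof -
  have X': "0 \<le> orient (fst v) X" "orient (fst v) X \<le> 1" using X orient_le by auto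
  have "(loc s (orient (fst v) X) (orient (snd v) 1),
      loc (above s) (orient (fst v) X) (orient (snd v) 0)) \<in> glue P"
  proof (cases "0 < snd v")
    case True
    then show ?thesis using glue_top[OF s X'] by (simp add: above_def orient_def)
  next
    case False
    then have "top_nb P (above s) = s"
      using s bij_top unfolding above_def bij_betw_def by (simp add: f_inv_into_f)
    then show ?thesis
      using False glue_sym[OF glue_top[OF above_in[OF s] X']] by (simp add: orient_def[of "snd v"])
  qed
  then show ?thesis
    unfolding pt_def using s above_in[OF s] X
    by (subst surface_point_eq_iff) (auto intro: loc_in_square_points)
qed

text \<open>Half-open coordinates select one representative of each edge point, since crossing an
  edge would turn 0 into the excluded value 1. Only the corner is ambiguous, where many squares may
  meet.\<close>

lemma pt_inject:
  assumes "s \<in> squares P" "s' \<in> squares P"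
    and XY: "0 \<le> X" "X < 1" "0 \<le> Y" "Y < 1" "\<not> (X = 0 \<and> Y = 0)"
    and XY': "0 \<le> X'" "X' < 1" "0 \<le> Y'" "Y' < 1"
    and eq: "pt s X Y = pt s' X' Y'"
  shows "s' = s \<and> X' = X \<and> Y' = Y"
proof -
  let ?q = "loc s' (orient (fst v) X') (orient (snd v) Y')"
  have orient01: "orient d x \<in> {0, 1} \<longleftrightarrow> x = 0" if "0 \<le> x" "x < 1" for d x
    using that by (auto simp: orient_def)
  have orient_one: "orient d x = 1 - orient d y \<longleftrightarrow> x = 1 - y" for d x y
    by (auto simp: orient_def)
  have orient_inj: "orient d x = orient d y \<longleftrightarrow> x = y" for d x y
    by (auto simp: orient_def)
  have "(loc s (orient (fst v) X) (orient (snd v) Y), ?q) \<in> glue P"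
    using eq assms unfolding pt_def
    by (subst (asm) surface_point_eq_iff) (auto intro: loc_in_square_points)
  then have "?q = loc s (orient (fst v) X) (orient (snd v) Y) \<or>
    X = 0 \<and> (\<exists>r. ?q = loc r (1 - orient (fst v) X) (orient (snd v) Y)) \<or>
    Y = 0 \<and> (\<exists>r. ?q = loc r (orient (fst v) X) (1 - orient (snd v) Y))"
    using glue_not_corner[of s "orient (fst v) X" "orient (snd v) Y" ?q] XY
      orient01[of X "fst v"] orient01[of Y "snd v"] by blast
  then show ?thesis
    using XY' by (auto simp: orient_inj orient_one)
qed

lemma pt_vertex: "\<lbrakk>s \<in> squares P; X \<in> {0, 1}; Y \<in> {0, 1}\<rbrakk> \<Longrightarrow> pt s X Y \<in> vertices P"
proof -
  assume s: "s \<in> squares P" and XY: "X \<in> {0, 1}" "Y \<in> {0, 1}"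
  have "s + (orient (fst v) X, orient (snd v) Y) \<in> corners s"
    using XY unfolding corners_def orient_def by (cases s) auto
  then show ?thesis
    using s unfolding vertices_def pt_def loc_def by blast
qed

lemma surface_points_pt:
  assumes "Z \<in> surface_points P"
  obtains s X Y where "s \<in> squares P" "0 \<le> X" "X \<le> 1" "0 \<le> Y" "Y \<le> 1" "Z = pt s X Y"
proof -
  obtain p where p: "p \<in> square_points P" "Z = glue P `` {p}"
    using assms unfolding surface_points_def by (rule quotientE)
  obtain s x y where s: "s \<in> squares P" "0 \<le> x" "x \<le> 1" "0 \<le> y" "y \<le> 1" "p = loc s x y"
    using square_points_cases[OF p(1)] .
  show thesis
    using that[of s "orient (fst v) x" "orient (snd v) y"] s p(2)
      orient_le[of "fst v" x] orient_le[of "snd v" y]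
    unfolding pt_def surface_point_def by simp
qed

lemma straight_on_pt:
  assumes "straight_on P v L I"
  obtains s X Y where "s \<in> squares P" "\<And>t. t \<in> I \<Longrightarrow>
    0 \<le> X + A * t \<and> X + A * t \<le> 1 \<and> 0 \<le> Y + B * t \<and> Y + B * t \<le> 1 \<and> L t = pt s (X + A * t) (Y + B * t)"
proof -
  obtain s z where s: "s \<in> squares P"
    and sz: "\<And>t. t \<in> I \<Longrightarrow> z + t *\<^sub>R v \<in> atomic s \<and> L t = surface_point P (s, z + t *\<^sub>R v)"
    using assms unfolding straight_on_def by blast
  let ?X = "orient (fst v) (fst z - fst s)" and ?Y = "orient (snd v) (snd z - snd s)"
  have z: "z + t *\<^sub>R v = s + (orient (fst v) (?X + A * t), orient (snd v) (?Y + B * t))" for t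
    unfolding orient_add[OF slopes(1)] orient_add[OF slopes(2)] orient_orient
    by (cases z; cases s; cases v) simp
  show thesis
  proof (rule that[OF s])
    fix t assume "t \<in> I"
    then show "0 \<le> ?X + A * t \<and> ?X + A * t \<le> 1 \<and> 0 \<le> ?Y + B * t \<and> ?Y + B * t \<le> 1
        \<and> L t = pt s (?X + A * t) (?Y + B * t)"
      using sz[of t] unfolding z mem_atomic pt_def loc_def using orient_le by blast
  qed
qed

lemma flat_dist_pt:
  assumes "s \<in> squares P" "0 \<le> X" "X \<le> 1" "0 \<le> Y" "Y \<le> 1" "0 \<le> X'" "X' \<le> 1" "0 \<le> Y'" "Y' \<le> 1"
  shows "flat_dist P (pt s X Y) (pt s X' Y') \<le> \<bar>X - X'\<bar> + \<bar>Y - Y'\<bar>"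
proof -
  have "\<bar>orient d x - orient d y\<bar> = \<bar>x - y\<bar>" for d x y
    by (auto simp: orient_def)
  then show ?thesis
    using flat_dist_square[OF assms(1), of "orient (fst v) X" "orient (snd v) Y" "orient (fst v) X'" "orient (snd v) Y'"]
      assms orient_le[of "fst v" X] orient_le[of "fst v" X'] orient_le[of "snd v" Y] orient_le[of "snd v" Y']
    unfolding pt_def by simp
qed

end

section \<open>Coding a geodesic that avoids the vertices by the exchange\<close>

locale oriented_path = oriented_surface +
  fixes L :: "real \<Rightarrow> point set"
  assumes geodesic: "half_geodesic P v L"
    and no_vertex: "0 \<le> t \<Longrightarrow> L t \<notin> vertices P"
begin

lemma straight_after: "0 \<le> t \<Longrightarrow> \<exists>b>t. straight_on P v L {t..b}"
  and straight_before: "0 < t \<Longrightarrow> \<exists>a\<ge>0. a < t \<and> straight_on P v L {a..t}"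
  using geodesic unfolding half_geodesic_def by blast+

text \<open>\<open>straight_on\<close> provides some square near each time; \<open>pt_inject\<close>
  identifies it with \<open>s\<close>, and real induction carries this along the chord.\<close>

lemma follows_chord:
  assumes s: "s \<in> squares P" and "0 \<le> \<tau>" and XY: "0 \<le> X" "X < 1" "0 \<le> Y" "Y < 1"
    and start: "L \<tau> = pt s X Y"
    and d: "0 \<le> d" "X + A * d \<le> 1" "Y + B * d \<le> 1"
  shows "L (\<tau> + d) = pt s (X + A * d) (Y + B * d)"
  using d(1)
proof (induction rule: real_induction)
  case base
  then show ?case using start by simp
next
  case (right e)
  have "A * e < A * d" "B * e < B * d" using right(2) AB_pos by simp_all
  then have lt: "X + A * e < 1" "Y + B * e < 1" using d by linarith+
  have ge: "0 \<le> X + A * e" "0 \<le> Y + B * e" using XY right(1) AB_pos by simp_all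
  have nv: "\<not> (X + A * e = 0 \<and> Y + B * e = 0)"
  proof
    assume "X + A * e = 0 \<and> Y + B * e = 0"
    then have "L (\<tau> + e) = pt s 0 0" using right(3) by simp
    then show False using no_vertex[of "\<tau> + e"] pt_vertex[OF s, of 0 0] right(1) \<open>0 \<le> \<tau>\<close> by simp
  qed
  obtain b where b: "\<tau> + e < b" "straight_on P v L {\<tau> + e..b}"
    using straight_after[of "\<tau> + e"] right(1) \<open>0 \<le> \<tau>\<close> by auto
  obtain s' X' Y' where s': "s' \<in> squares P" and st: "\<And>t. t \<in> {\<tau> + e..b} \<Longrightarrow>
    0 \<le> X' + A * t \<and> X' + A * t \<le> 1 \<and> 0 \<le> Y' + B * t \<and> Y' + B * t \<le> 1 \<and> L t = pt s' (X' + A * t) (Y' + B * t)"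
    using straight_on_pt[OF b(2)] by blast
  \<comment> \<open>Both coordinates increase and stay at most 1 until time \<open>b\<close>, so at
    the start of the piece they are below 1, as \<open>pt_inject\<close> requires.\<close>
  have "A * (\<tau> + e) < A * b" "B * (\<tau> + e) < B * b" using b(1) AB_pos by simp_all
  then have lt': "X' + A * (\<tau> + e) < 1" "Y' + B * (\<tau> + e) < 1" using st[of b] b(1) by simp_all
  have eq: "s' = s \<and> X' + A * (\<tau> + e) = X + A * e \<and> Y' + B * (\<tau> + e) = Y + B * e"
  proof (rule pt_inject[OF s s' ge(1) lt(1) ge(2) lt(2) nv])
    show "pt s (X + A * e) (Y + B * e) = pt s' (X' + A * (\<tau> + e)) (Y' + B * (\<tau> + e))"
      using st[of "\<tau> + e"] b(1) right(3) by simp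
  qed (use st[of "\<tau> + e"] b(1) lt' in simp_all)
  have "L (\<tau> + y) = pt s (X + A * y) (Y + B * y)" if "e \<le> y" "y \<le> b - \<tau>" for y
  proof -
    have "L (\<tau> + y) = pt s' (X' + A * (\<tau> + y)) (Y' + B * (\<tau> + y))"
      using st[of "\<tau> + y"] that by simp
    moreover have "X' + A * (\<tau> + y) = X + A * y" "Y' + B * (\<tau> + y) = Y + B * y"
      using eq unfolding distrib_left by linarith+
    ultimately show ?thesis using eq by simp
  qed
  then show ?case using b(1) by (intro exI[of _ "b - \<tau>"]) simp
next
  case (left e)
  obtain a where a: "0 \<le> a" "a < \<tau> + e" "straight_on P v L {a..\<tau> + e}"
    using straight_before[of "\<tau> + e"] left(1) \<open>0 \<le> \<tau>\<close> by auto
  obtain s' X' Y' where s': "s' \<in> squares P" and st: "\<And>t. t \<in> {a..\<tau> + e} \<Longrightarrow>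
    0 \<le> X' + A * t \<and> X' + A * t \<le> 1 \<and> 0 \<le> Y' + B * t \<and> Y' + B * t \<le> 1 \<and> L t = pt s' (X' + A * t) (Y' + B * t)"
    using straight_on_pt[OF a(3)] by blast
  \<comment> \<open>The squares are compared at an earlier time, when the point is strictly inside
    \<open>s\<close>; at the end of the chord it may be on an exit edge, outside the half-open
    range.\<close>
  define y where "y = (max (a - \<tau>) 0 + e) / 2"
  have "a - \<tau> < e" using a(2) by simp
  then have y: "0 < y" "y < e" "a \<le> \<tau> + y"
    using left(1) unfolding y_def by (auto simp: max_def field_simps)
  have "A * y < A * e" "B * y < B * e" "A * e \<le> A * d" "B * e \<le> B * d"
    using y left(2) AB_pos by simp_all
  then have lt: "X + A * y < 1" "Y + B * y < 1" using d by linarith+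
  have gt: "0 < X + A * y" "0 < Y + B * y" using XY y AB_pos by (simp_all add: add_nonneg_pos)
  have "A * (\<tau> + y) < A * (\<tau> + e)" "B * (\<tau> + y) < B * (\<tau> + e)" using y AB_pos by simp_all
  then have lt': "X' + A * (\<tau> + y) < 1" "Y' + B * (\<tau> + y) < 1" using st[of "\<tau> + e"] a(2) by simp_all
  have same: "pt s (X + A * y) (Y + B * y) = pt s' (X' + A * (\<tau> + y)) (Y' + B * (\<tau> + y))"
    using left(3)[of y] y st[of "\<tau> + y"] by simp
  have eq: "s' = s \<and> X' + A * (\<tau> + y) = X + A * y \<and> Y' + B * (\<tau> + y) = Y + B * y"
    by (rule pt_inject[OF s s' less_imp_le[OF gt(1)] lt(1) less_imp_le[OF gt(2)] lt(2) _ _ lt'(1) _ lt'(2) same])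
       (use gt st[of "\<tau> + y"] y in simp_all)
  have "L (\<tau> + e) = pt s' (X' + A * (\<tau> + e)) (Y' + B * (\<tau> + e))"
    using st[of "\<tau> + e"] a(2) by simp
  moreover have "X' + A * (\<tau> + e) = X + A * e" "Y' + B * (\<tau> + e) = Y + B * e"
    using eq unfolding distrib_left by linarith+
  ultimately show ?case using eq by simp
qed

text \<open>On an entry side the whole chord of the square still lies ahead of the geodesic, which
  is what \<open>enters_chord\<close> exploits.\<close>

definition enters :: "real \<Rightarrow> (real \<times> real) \<times> real \<Rightarrow> bool" where
  "enters \<tau> p \<longleftrightarrow> 0 \<le> \<tau> \<and> fst p \<in> squares P \<and>
     (\<exists>X Y. 0 \<le> X \<and> X < 1 \<and> 0 \<le> Y \<and> Y < 1 \<and> (X = 0 \<or> Y = 0) \<and>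
        snd p = B * X - A * Y \<and> L \<tau> = pt (fst p) X Y)"

lemma enters_step:
  assumes s: "s \<in> squares P" and "0 \<le> \<tau>" and XY: "0 \<le> X" "X < 1" "0 \<le> Y" "Y < 1"
    and start: "L \<tau> = pt s X Y"
  shows "\<exists>\<tau>'. \<tau> \<le> \<tau>' \<and> \<tau>' \<le> \<tau> + 1 / A \<and> enters \<tau>' (step crossing (s, B * X - A * Y))"
proof -
  note follow = follows_chord[OF s \<open>0 \<le> \<tau>\<close> XY start]
  \<comment> \<open>\<open>d\<close> and \<open>e\<close> are the times at which the chord meets the
    exit side and the top. The earlier one decides the letter, and a tie would mean hitting a
    vertex.\<close>
  define d where "d = (1 - X) / A"
  define e where "e = (1 - Y) / B"
  have d: "0 < d" "A * d = 1 - X" "d \<le> 1 / A"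
    using XY AB_pos unfolding d_def by (auto simp: divide_right_mono)
  have e: "0 < e" "B * e = 1 - Y"
    using XY AB_pos unfolding e_def by auto
  show ?thesis
  proof (cases "e < d")
    case True
    have lt: "A * e < A * d" using True AB_pos by simp
    then have "B * (A * e) < B * (A * d)" using AB_pos by simp
    moreover have BAe: "B * (A * e) = A * (1 - Y)" unfolding e(2)[symmetric] by (rule mult.left_commute)
    ultimately have "A * (1 - Y) < B * (1 - X)" using d(2) by simp
    then have letter: "letter crossing (s, B * X - A * Y)"
      by (simp add: letter_def crossing_def algebra_simps)
    have X': "0 \<le> X + A * e" "X + A * e < 1" using lt d(2) XY e(1) AB_pos by simp_all
    have "L (\<tau> + e) = pt s (X + A * e) 1"
      using follow[of e] X' e(1) unfolding e(2) by simp
    also have "\<dots> = pt (above s) (X + A * e) 0"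
      using X' by (intro pt_above s) auto
    finally have L: "L (\<tau> + e) = pt (above s) (X + A * e) 0" .
    have "B * X - A * Y + A = B * (X + A * e) - A * 0"
      using BAe by (simp add: algebra_simps)
    then have "enters (\<tau> + e) (above s, B * X - A * Y + A)"
      unfolding enters_def fst_conv snd_conv using L X' above_in[OF s] \<open>0 \<le> \<tau>\<close> e(1)
      by (intro conjI exI[of _ "X + A * e"] exI[of _ 0]) simp_all
    moreover have "step crossing (s, B * X - A * Y) = (above s, B * X - A * Y + A)"
      using letter by (simp add: step_def shift_def crossing_def)
    ultimately show ?thesis
      using e d True by (intro exI[of _ "\<tau> + e"]) simp
  next
    case False
    have "d \<noteq> e"
    proof
      assume "d = e"
      then have "B * d = 1 - Y" using e(2) by simp
      then have "L (\<tau> + d) = pt s 1 1" using follow[of d] d(1) unfolding d(2) by simp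
      then show False using pt_vertex[OF s, of 1 1] no_vertex[of "\<tau> + d"] \<open>0 \<le> \<tau>\<close> d(1) by simp
    qed
    then have "d < e" using False by simp
    then have lt: "B * d < B * e" using AB_pos by simp
    then have "A * (B * d) < A * (B * e)" using AB_pos by simp
    moreover have ABd: "A * (B * d) = B * (1 - X)" unfolding d(2)[symmetric] by (rule mult.left_commute)
    ultimately have "B * (1 - X) < A * (1 - Y)" using e(2) by simp
    then have letter: "\<not> letter crossing (s, B * X - A * Y)"
      by (simp add: letter_def crossing_def algebra_simps)
    have Y': "0 \<le> Y + B * d" "Y + B * d < 1" using lt e(2) XY d(1) AB_pos by simp_all
    have "L (\<tau> + d) = pt s 1 (Y + B * d)"
      using follow[of d] Y' d(1) unfolding d(2) by simp
    also have "\<dots> = pt (ahead s) 0 (Y + B * d)"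
      using Y' by (intro pt_ahead s) auto
    finally have L: "L (\<tau> + d) = pt (ahead s) 0 (Y + B * d)" .
    have "B * X - A * Y - B = B * 0 - A * (Y + B * d)"
      using ABd by (simp add: algebra_simps)
    then have "enters (\<tau> + d) (ahead s, B * X - A * Y - B)"
      unfolding enters_def fst_conv snd_conv using L Y' ahead_in[OF s] \<open>0 \<le> \<tau>\<close> d(1)
      by (intro conjI exI[of _ 0] exI[of _ "Y + B * d"]) simp_all
    moreover have "step crossing (s, B * X - A * Y) = (ahead s, B * X - A * Y - B)"
      using letter by (simp add: step_def shift_def crossing_def)
    ultimately show ?thesis
      using d by (intro exI[of _ "\<tau> + d"]) simp
  qed
qed

lemma enters_states: "enters \<tau> p \<Longrightarrow> p \<in> states (squares P) crossing"
proof -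
  assume "enters \<tau> p"
  then obtain X Y where s: "fst p \<in> squares P" and XY: "0 \<le> X" "X < 1" "0 \<le> Y" "Y < 1"
    and p: "snd p = B * X - A * Y"
    unfolding enters_def by blast
  have "B * X < B" "A * Y \<le> A" "0 \<le> B * X" "0 \<le> A * Y" using XY AB_pos by simp_all
  then show "p \<in> states (squares P) crossing"
    using s p unfolding states_def crossing_def by (cases p) simp
qed

lemma first_entry: "\<exists>\<tau> p. \<tau> \<le> 1 / A \<and> enters \<tau> p"
proof -
  obtain b where b: "0 < b" "straight_on P v L {0..b}"
    using straight_after[of 0] by auto
  obtain s X Y where s: "s \<in> squares P" and st: "\<And>t. t \<in> {0..b} \<Longrightarrow>
    0 \<le> X + A * t \<and> X + A * t \<le> 1 \<and> 0 \<le> Y + B * t \<and> Y + B * t \<le> 1 \<and> L t = pt s (X + A * t) (Y + B * t)"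
    using straight_on_pt[OF b(2)] by blast
  have "0 < A * b" "0 < B * b" using b(1) AB_pos by simp_all
  then have "0 \<le> X" "X < 1" "0 \<le> Y" "Y < 1" "L 0 = pt s X Y"
    using st[of 0] st[of b] b(1) by simp_all
  from enters_step[OF s order_refl this] show ?thesis unfolding add_0_left by blast
qed

lemma enters_orbit:
  assumes "enters \<tau> p"
  shows "\<exists>\<tau>'. \<tau>' \<le> \<tau> + real j / A \<and> enters \<tau>' ((step crossing ^^ j) p)"
proof (induction j)
  case 0
  then show ?case using assms by auto
next
  case (Suc j)
  then obtain \<tau>' where \<tau>': "\<tau>' \<le> \<tau> + real j / A" "enters \<tau>' ((step crossing ^^ j) p)" by blast
  obtain s \<eta> where p: "(step crossing ^^ j) p = (s, \<eta>)" by (cases "(step crossing ^^ j) p")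
  obtain X Y where XY: "0 \<le> \<tau>'" "s \<in> squares P" "0 \<le> X" "X < 1" "0 \<le> Y" "Y < 1"
    "\<eta> = B * X - A * Y" "L \<tau>' = pt s X Y"
    using \<tau>'(2) unfolding enters_def p by auto
  obtain \<tau>'' where "\<tau>'' \<le> \<tau>' + 1 / A" "enters \<tau>'' (step crossing (s, \<eta>))"
    using enters_step[OF XY(2,1,3-6,8)] XY(7) by blast
  then show ?case
    using \<tau>'(1) p by (intro exI[of _ \<tau>'']) (simp add: add_divide_distrib)
qed

end

text \<open>Move horizontally until the coordinate is \<open>\<eta>\<close>; if this would leave the
  square, stop at the vertical side in the way and go on along that side.\<close>

lemma chord_near_point:
  fixes A B :: real
  assumes "0 < A" "0 < B" and XY: "0 \<le> X" "X \<le> 1" "0 \<le> Y" "Y \<le> 1" and \<eta>: "- A \<le> \<eta>" "\<eta> \<le> B"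
  shows "\<exists>X' Y'. 0 \<le> X' \<and> X' \<le> 1 \<and> 0 \<le> Y' \<and> Y' \<le> 1 \<and> B * X' - A * Y' = \<eta> \<and>
    \<bar>X - X'\<bar> + \<bar>Y - Y'\<bar> \<le> \<bar>\<eta> - (B * X - A * Y)\<bar> * (1 / A + 1 / B)"
proof -
  define h where "h = B * X - A * Y"
  define D where "D = \<bar>\<eta> - h\<bar>"
  have D: "0 \<le> D / A" "0 \<le> D / B" "D * (1 / A + 1 / B) = D / A + D / B"
    using assms(1,2) unfolding D_def by (auto simp: algebra_simps)
  have by_X: ?thesis if "0 \<le> X + (\<eta> - h) / B" "X + (\<eta> - h) / B \<le> 1"
  proof -
    have "B * (X + (\<eta> - h) / B) - A * Y = \<eta>"
      using assms(2) unfolding h_def by (simp add: field_simps)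
    moreover have "\<bar>X - (X + (\<eta> - h) / B)\<bar> + \<bar>Y - Y\<bar> \<le> D * (1 / A + 1 / B)"
      using D assms(2) unfolding D_def by simp
    ultimately show ?thesis
      using that XY unfolding D_def h_def[symmetric] by blast
  qed
  have by_corner: ?thesis if c: "c = 0 \<or> c = 1" "0 \<le> (B * c - \<eta>) / A" "(B * c - \<eta>) / A \<le> 1"
      "\<bar>X - c\<bar> \<le> D / B" "\<bar>A * Y - (B * c - \<eta>)\<bar> \<le> D" for c
  proof -
    have "B * c - A * ((B * c - \<eta>) / A) = \<eta>" using assms(1) by simp
    moreover have "\<bar>Y - (B * c - \<eta>) / A\<bar> \<le> D / A"
    proof -
      have "Y - (B * c - \<eta>) / A = (A * Y - (B * c - \<eta>)) / A"
        using assms(1) by (simp add: field_simps)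
      then have "\<bar>Y - (B * c - \<eta>) / A\<bar> = \<bar>A * Y - (B * c - \<eta>)\<bar> / A"
        using assms(1) by simp
      then show ?thesis using c(5) assms(1) by (simp add: divide_right_mono)
    qed
    ultimately show ?thesis
      using that D(3) unfolding D_def[symmetric] h_def[symmetric]
      by (intro exI[of _ c] exI[of _ "(B * c - \<eta>) / A"]) auto
  qed
  consider "0 \<le> X + (\<eta> - h) / B" "X + (\<eta> - h) / B \<le> 1" | "X + (\<eta> - h) / B > 1" | "X + (\<eta> - h) / B < 0"
    by linarith
  then show ?thesis
  proof cases
    case 1
    then show ?thesis by (rule by_X)
  next
    case 2
    then have gt: "B - B * X < \<eta> - h" using assms(2) by (simp add: field_simps)
    have "0 \<le> B - B * X" using XY assms(2) by (simp add: mult_left_le)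
    then have D': "D = \<eta> - h" using gt unfolding D_def by simp
    have "A * Y \<le> A" using XY assms(1) by simp
    show ?thesis
    proof (rule by_corner[of 1])
      show "0 \<le> (B * 1 - \<eta>) / A" using \<eta> assms(1) by simp
      have "B - \<eta> \<le> A" using gt \<open>A * Y \<le> A\<close> unfolding h_def by linarith
      then show "(B * 1 - \<eta>) / A \<le> 1" using assms(1) by simp
      show "\<bar>X - 1\<bar> \<le> D / B" using gt XY assms(2) unfolding D' by (simp add: field_simps)
      show "\<bar>A * Y - (B * 1 - \<eta>)\<bar> \<le> D" using gt \<open>0 \<le> B - B * X\<close> unfolding D' h_def by simp
    qed simp
  next
    case 3
    then have lt: "\<eta> - h < - (B * X)" using assms(2) by (simp add: field_simps)
    have "0 \<le> B * X" using XY assms(2) by simp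
    then have D': "D = h - \<eta>" using lt unfolding D_def by simp
    have "0 \<le> A * Y" using XY assms(1) by simp
    show ?thesis
    proof (rule by_corner[of 0])
      have "\<eta> \<le> 0" using lt \<open>0 \<le> A * Y\<close> unfolding h_def by linarith
      then show "0 \<le> (B * 0 - \<eta>) / A" using assms(1) by (simp add: divide_nonpos_pos)
      show "(B * 0 - \<eta>) / A \<le> 1" using \<eta> assms(1) unfolding pos_divide_le_eq[OF assms(1)] by simp
      show "\<bar>X - 0\<bar> \<le> D / B" using lt XY assms(2) unfolding D' by (simp add: field_simps)
      show "\<bar>A * Y - (B * 0 - \<eta>)\<bar> \<le> D" using lt \<open>0 \<le> B * X\<close> unfolding D' h_def by simp
    qed simp
  qed
qed

section \<open>From dense orbits of the exchange to superdensity\<close>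

context oriented_path
begin

lemma enters_chord:
  assumes "enters \<tau> (s, B * X - A * Y)" and XY: "0 \<le> X" "X \<le> 1" "0 \<le> Y" "Y \<le> 1"
  shows "\<exists>t. 0 \<le> t \<and> t \<le> \<tau> + 1 / A \<and> L t = pt s X Y"
proof -
  obtain X0 Y0 where p: "0 \<le> \<tau>" "s \<in> squares P" "0 \<le> X0" "X0 < 1" "0 \<le> Y0" "Y0 < 1" "X0 = 0 \<or> Y0 = 0"
    "B * X - A * Y = B * X0 - A * Y0" "L \<tau> = pt s X0 Y0"
    using assms(1) unfolding enters_def by auto
  define d where "d = (X - X0) / A"
  have A: "A * d = X - X0" using AB_pos unfolding d_def by simp
  have "A * (B * d) = B * (X - X0)" unfolding A[symmetric] by (rule mult.left_commute)
  also have "\<dots> = A * (Y - Y0)" using p(8) by (simp add: algebra_simps)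
  finally have B: "B * d = Y - Y0" using AB_pos by simp
  have "0 \<le> d"
  proof -
    have "0 \<le> A * d \<or> 0 \<le> B * d" unfolding A B using p(7) XY by auto
    then show ?thesis using AB_pos by (auto simp: zero_le_mult_iff)
  qed
  moreover have "d \<le> 1 / A" unfolding d_def using p(3) XY AB_pos by (intro divide_right_mono) auto
  moreover have "L (\<tau> + d) = pt s X Y"
    using follows_chord[OF p(2,1,3-6,9) \<open>0 \<le> d\<close>] XY unfolding A B by simp
  ultimately show ?thesis
    using p(1) by (intro exI[of _ "\<tau> + d"]) simp
qed

lemma superdense_if_bad:
  assumes "c > 0" and bad: "\<And>i j :: nat. (i, j) \<noteq> (0, 0) \<Longrightarrow>
      c \<le> \<bar>real i * A - real j * B\<bar> * real (i + j)"
  shows "superdense P L"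
proof -
  have len: "len crossing True = B" "len crossing False = A"
    by (simp_all add: crossing_def)
  interpret X: skew_exchange "squares P" crossing "(B + A) / c"
    unfolding len[symmetric]
  proof (rule skew_exchangeI)
    show "bij_betw (perm crossing b) (squares P) (squares P)" for b
      using bij_ahead bij_above by (simp add: crossing_def)
    show "M = squares P" if "M \<subseteq> squares P" "M \<noteq> {}" "\<And>b. perm crossing b ` M \<subseteq> M" for M
      using that(3)[of True] that(3)[of False] that(1,2)
      by (intro crossing_transitive) (simp_all add: crossing_def)
    show "0 < len crossing b" for b
      using AB_pos by (simp add: crossing_def)
    show "c \<le> \<bar>real i * len crossing False - real j * len crossing True\<bar> * real (i + j)"
      if "(i, j) \<noteq> (0, 0)" for i j :: nat
      unfolding len by (rule bad[OF that])
  qed (use finite_squares \<open>c > 0\<close> in auto)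
  obtain C where "C > 0" and C: "\<And>n p q. \<lbrakk>1 \<le> n; p \<in> states (squares P) crossing; q \<in> states (squares P) crossing\<rbrakk>
      \<Longrightarrow> \<exists>j. real j \<le> C * real n \<and> fst ((step crossing ^^ j) p) = fst q \<and>
        \<bar>snd ((step crossing ^^ j) p) - snd q\<bar> \<le> 1 / real n"
    using X.orbits_superdense by blast
  obtain \<tau> p where \<tau>: "\<tau> \<le> 1 / A" "enters \<tau> p"
    using first_entry by blast
  \<comment> \<open>\<open>N\<close> absorbs the factor of \<open>chord_near_point\<close> and two
    errors 1 / m, one from the orbit and one from replacing \<open>h\<close> by
    \<open>h'\<close>.\<close>
  define N where "N = nat \<lceil>2 * (1 / A + 1 / B)\<rceil>"
  have N: "2 * (1 / A + 1 / B) \<le> real N" unfolding N_def by linarith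
  have "0 < 2 * (1 / A + 1 / B)"
    using AB_pos by (intro mult_pos_pos add_pos_pos divide_pos_pos) auto
  then have "1 \<le> N" using N by (cases N) auto
  \<comment> \<open>The 2 stands for the time before the first entry and the time on the last chord,
    each at most 1 / A.\<close>
  define K where "K = (C * real N + 2) / A"
  have "\<exists>t. 0 \<le> t \<and> t \<le> K * real n \<and> flat_dist P (L t) Z \<le> 1 / real n"
    if n: "1 \<le> n" and Z: "Z \<in> surface_points P" for n Z
  proof -
    obtain s X Y where s: "s \<in> squares P" and XY: "0 \<le> X" "X \<le> 1" "0 \<le> Y" "Y \<le> 1" and ZX: "Z = pt s X Y"
      using surface_points_pt[OF Z] .
    define m where "m = N * n"
    have m: "1 \<le> m" using n \<open>1 \<le> N\<close> unfolding m_def by simp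
    define h where "h = B * X - A * Y"
    have "B * X \<le> B" "A * Y \<le> A" "0 \<le> B * X" "0 \<le> A * Y" using XY AB_pos by simp_all
    then have h: "- A \<le> h" "h \<le> B" unfolding h_def by linarith+
    \<comment> \<open>\<open>states\<close> omits the right end B, which \<open>h\<close> attains at
      a corner; there it is lowered by at most 1 / m without passing the left end.\<close>
    define h' where "h' = (if h < B then h else max (- A) (B - 1 / real m))"
    have h': "- A \<le> h'" "h' < B" "\<bar>h' - h\<bar> \<le> 1 / real m"
      using h m AB_pos unfolding h'_def by (auto simp: max_def)
    have "(s, h') \<in> states (squares P) crossing"
      using s h' len by (simp add: states_def)
    then obtain j where j: "real j \<le> C * real m" "fst ((step crossing ^^ j) p) = s"
      "\<bar>snd ((step crossing ^^ j) p) - h'\<bar> \<le> 1 / real m"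
      using C[OF m enters_states[OF \<tau>(2)], of "(s, h')"] unfolding fst_conv snd_conv by blast
    define \<eta> where "\<eta> = snd ((step crossing ^^ j) p)"
    obtain \<tau>' where \<tau>': "\<tau>' \<le> \<tau> + real j / A" "enters \<tau>' (s, \<eta>)"
      using enters_orbit[OF \<tau>(2), of j] unfolding j(2)[symmetric] \<eta>_def prod.collapse by blast
    have \<eta>: "- A \<le> \<eta>" "\<eta> \<le> B"
      using enters_states[OF \<tau>'(2)] len by (auto simp: states_def)
    obtain X' Y' where X': "0 \<le> X'" "X' \<le> 1" "0 \<le> Y'" "Y' \<le> 1" "B * X' - A * Y' = \<eta>"
      and close: "\<bar>X - X'\<bar> + \<bar>Y - Y'\<bar> \<le> \<bar>\<eta> - h\<bar> * (1 / A + 1 / B)"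
      using chord_near_point[OF AB_pos XY \<eta>] unfolding h_def by blast
    obtain t where t: "0 \<le> t" "t \<le> \<tau>' + 1 / A" "L t = pt s X' Y'"
      using enters_chord[of \<tau>' s X' Y'] \<tau>'(2) X' by auto
    have "t \<le> (real j + 2) / A"
      using t(2) \<tau>'(1) \<tau>(1) by (simp add: add_divide_distrib)
    also have "\<dots> \<le> (C * real m + 2 * real n) / A"
      using j(1) n AB_pos by (intro divide_right_mono) auto
    also have "\<dots> = K * real n"
      unfolding K_def m_def by (simp add: algebra_simps add_divide_distrib)
    finally have "t \<le> K * real n" .
    moreover have "flat_dist P (L t) Z \<le> 1 / real n"
    proof -
      have "flat_dist P (L t) Z \<le> \<bar>X' - X\<bar> + \<bar>Y' - Y\<bar>"
        unfolding t(3) ZX by (rule flat_dist_pt[OF s X'(1-4) XY])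
      also have "\<dots> \<le> \<bar>\<eta> - h\<bar> * (1 / A + 1 / B)"
        using close by (simp add: abs_minus_commute)
      also have "\<dots> \<le> (2 / real m) * (1 / A + 1 / B)"
        using j(3) h'(3) AB_pos unfolding \<eta>_def by (intro mult_right_mono) auto
      also have "\<dots> = 2 * (1 / A + 1 / B) / real m" by simp
      also have "\<dots> \<le> real N / real m"
        using N by (intro divide_right_mono) auto
      also have "\<dots> = 1 / real n"
        using \<open>1 \<le> N\<close> unfolding m_def by simp
      finally show ?thesis .
    qed
    ultimately show ?thesis using t(1) by blast
  qed
  moreover have "K > 0"
    unfolding K_def using \<open>C > 0\<close> AB_pos by (intro divide_pos_pos add_nonneg_pos mult_nonneg_nonneg) auto
  ultimately show ?thesis
    unfolding superdense_def by blast
qed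

end

section \<open>Linear forms along a superdense geodesic\<close>


text \<open>Modulo 1 this is the pullback of a character of the unit torus, since gluings change
  local coordinates by integers.\<close>

definition level :: "int \<Rightarrow> int \<Rightarrow> point \<Rightarrow> real" where
  "level m k p = of_int m * (fst (snd p) - fst (fst p)) + of_int k * (snd (snd p) - snd (fst p))"

lemma level_loc: "level m k (loc s x y) = of_int m * x + of_int k * y"
  by (simp add: level_def loc_def)

lemma level_line:
  "level m k (s, z + t *\<^sub>R v) = level m k (s, z) + t * (of_int m * fst v + of_int k * snd v)"
  by (simp add: level_def algebra_simps)

context flat_surface
begin

lemma level_glue:
  assumes "(p, q) \<in> glue P"
  shows "level m k p - level m k q \<in> \<int>"
proof -
  have edge: "level m k x - level m k y \<in> \<int>" if "(x, y) \<in> edge_glue P" for x y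
    using that by (rule edge_glueE) (simp_all add: level_loc)
  have "q \<in> {r. level m k p - level m k r \<in> \<int>}"
  proof (rule glue_closed[OF assms])
    fix x y assume x: "x \<in> {r. level m k p - level m k r \<in> \<int>}"
      and "(x, y) \<in> edge_glue P \<or> (y, x) \<in> edge_glue P"
    then have "level m k x - level m k y \<in> \<int>"
      using edge[of x y] edge[of y x] Ints_minus[of "level m k y - level m k x"] by auto
    then show "y \<in> {r. level m k p - level m k r \<in> \<int>}"
      using x Ints_add[of "level m k p - level m k x" "level m k x - level m k y"] by simp
  qed simp
  then show ?thesis by simp
qed

lemma level_broken_line:
  "broken_line P p q l \<Longrightarrow> \<exists>j\<in>\<int>. \<bar>level m k p - level m k q - j\<bar> \<le> (\<bar>of_int m\<bar> + \<bar>of_int k\<bar>) * l"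
proof (induction rule: broken_line.induct)
  case (segment s z w)
  have "level m k (s, z) - level m k (s, w) = of_int m * (fst z - fst w) + of_int k * (snd z - snd w)"
    by (simp add: level_def algebra_simps)
  also have "\<bar>\<dots>\<bar> \<le> \<bar>of_int m * (fst z - fst w)\<bar> + \<bar>of_int k * (snd z - snd w)\<bar>"
    by (rule abs_triangle_ineq)
  also have "\<dots> \<le> \<bar>of_int m\<bar> * dist z w + \<bar>of_int k\<bar> * dist z w"
    unfolding abs_mult using dist_fst_le[of z w] dist_snd_le[of z w]
    by (intro add_mono mult_left_mono) (simp_all add: dist_real_def)
  finally show ?case by (intro bexI[of _ 0]) (simp_all add: distrib_right)
next
  case (cross p q)
  then show ?case using level_glue[OF cross, of m k] by (intro bexI[of _ "level m k p - level m k q"]) simp_all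
next
  case (join p q a r b)
  then obtain i j where "i \<in> \<int>" "\<bar>level m k p - level m k q - i\<bar> \<le> (\<bar>of_int m\<bar> + \<bar>of_int k\<bar>) * a"
    "j \<in> \<int>" "\<bar>level m k q - level m k r - j\<bar> \<le> (\<bar>of_int m\<bar> + \<bar>of_int k\<bar>) * b"
    by blast
  then show ?case
    unfolding distrib_left by (intro bexI[of _ "i + j"]) (linarith, simp)
qed

text \<open>Makes the set in \<open>flat_dist\<close> nonempty, so that its infimum is approached by
  actual broken lines.\<close>

lemma broken_line_exists:
  assumes "p \<in> square_points P" "q \<in> square_points P"
  shows "\<exists>l. broken_line P p q l"
proof -
  define M where "M = {s \<in> squares P. \<exists>l. broken_line P p (loc s 0 0) l}"
  have seg: "\<exists>l. broken_line P (loc s x y) (loc s x' y') l"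
    if "s \<in> squares P" "loc s x y \<in> square_points P" "loc s x' y' \<in> square_points P" for s x y x' y'
  proof -
    have "s + (x, y) \<in> atomic s" "s + (x', y') \<in> atomic s"
      using that(2,3) unfolding square_points_iff mem_atomic by blast+
    from broken_line.segment[OF that(1) this] show ?thesis unfolding loc_def by blast
  qed
  have "M = squares P"
  proof (rule squares_connected)
    obtain s x y where s: "s \<in> squares P" "0 \<le> x" "x \<le> 1" "0 \<le> y" "y \<le> 1" "p = loc s x y"
      using square_points_cases[OF assms(1)] .
    show "M \<noteq> {}"
    proof -
      have "\<exists>l. broken_line P (loc s x y) (loc s 0 0) l"
        using s by (intro seg) (simp_all add: square_points_iff)
      then have "s \<in> M" using s unfolding M_def by blast
      then show ?thesis by blast
    qed
    have next_square: "q \<in> M" if "s \<in> M" "q \<in> squares P" "loc s x y \<in> square_points P" "(loc s x y, loc q 0 0) \<in> glue P" for s q x y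
    proof -
      obtain l where "broken_line P p (loc s 0 0) l" using \<open>s \<in> M\<close> unfolding M_def by blast
      moreover have "\<exists>l. broken_line P (loc s 0 0) (loc s x y) l"
        using that(1,3) unfolding M_def by (intro seg) (auto simp: square_points_iff)
      then obtain l' where "broken_line P (loc s 0 0) (loc s x y) l'" by blast
      ultimately have "broken_line P p (loc q 0 0) (l + (l' + 0))"
        using broken_line.cross[OF that(4)] broken_line.join by blast
      then show ?thesis using that(2) unfolding M_def by blast
    qed
    have MS: "s \<in> squares P" if "s \<in> M" for s using that unfolding M_def by blast
    show "right_nb P ` M \<subseteq> M"
    proof
      fix q assume "q \<in> right_nb P ` M"
      then obtain s where s: "s \<in> M" "q = right_nb P s" by blast
      show "q \<in> M"
        using next_square[of s q 1 0] s MS[OF s(1)] nb_in(1)[OF MS[OF s(1)]] glue_right[OF MS[OF s(1)], of 0]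
        by (simp add: square_points_iff)
    qed
    show "top_nb P ` M \<subseteq> M"
    proof
      fix q assume "q \<in> top_nb P ` M"
      then obtain s where s: "s \<in> M" "q = top_nb P s" by blast
      show "q \<in> M"
        using next_square[of s q 0 1] s MS[OF s(1)] nb_in(2)[OF MS[OF s(1)]] glue_top[OF MS[OF s(1)], of 0]
        by (simp add: square_points_iff)
    qed
  qed (simp add: M_def)
  moreover obtain s x y where s: "s \<in> squares P" "0 \<le> x" "x \<le> 1" "0 \<le> y" "y \<le> 1" "q = loc s x y"
    using square_points_cases[OF assms(2)] .
  ultimately obtain l where "broken_line P p (loc s 0 0) l" unfolding M_def by blast
  moreover obtain l' where "broken_line P (loc s 0 0) q l'"
    using seg[of s 0 0 x y] s by (auto simp: square_points_iff)
  ultimately show ?thesis using broken_line.join by blast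
qed

lemma level_flat_dist:
  assumes p: "p \<in> square_points P" and q: "q \<in> square_points P"
    and less: "flat_dist P (surface_point P p) (surface_point P q) < e" and "(m, k) \<noteq> (0, 0)"
  shows "\<exists>j\<in>\<int>. \<bar>level m k p - level m k q - j\<bar> < (\<bar>of_int m\<bar> + \<bar>of_int k\<bar>) * e"
proof -
  obtain l0 where "broken_line P p q l0" using broken_line_exists[OF p q] by blast
  moreover have "p \<in> surface_point P p" "q \<in> surface_point P q"
    using p q by (simp_all add: surface_point_def glue_refl)
  ultimately have "{l. \<exists>p'\<in>surface_point P p. \<exists>q'\<in>surface_point P q. broken_line P p' q' l} \<noteq> {}"
    by blast
  from cInf_lessD[OF this less[unfolded flat_dist_def]]
  obtain p' q' l where p': "(p, p') \<in> glue P" and q': "(q, q') \<in> glue P"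
    and l: "broken_line P p' q' l" "l < e"
    unfolding surface_point_def by auto
  obtain j where j: "j \<in> \<int>" "\<bar>level m k p' - level m k q' - j\<bar> \<le> (\<bar>of_int m\<bar> + \<bar>of_int k\<bar>) * l"
    using level_broken_line[OF l(1)] by blast
  define i where "i = (level m k p - level m k p') - (level m k q - level m k q') + j"
  have "i \<in> \<int>"
    unfolding i_def using level_glue[OF p'] level_glue[OF q'] j(1) by simp
  have "0 < \<bar>real_of_int m\<bar> + \<bar>real_of_int k\<bar>"
    using \<open>(m, k) \<noteq> (0, 0)\<close> by auto
  then have "(\<bar>real_of_int m\<bar> + \<bar>real_of_int k\<bar>) * l < (\<bar>real_of_int m\<bar> + \<bar>real_of_int k\<bar>) * e"
    using l(2) by (rule mult_strict_left_mono[rotated])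
  moreover have "level m k p - level m k q - i = level m k p' - level m k q' - j"
    unfolding i_def by simp
  ultimately show ?thesis
    using j(2) \<open>i \<in> \<int>\<close> by (intro bexI[of _ i]) simp_all
qed

text \<open>On a straight piece the level is affine in time with the stated slope. Pieces sharing a
  time have offsets that differ by an integer, so real induction yields one offset for all
  times.\<close>

lemma level_along_geodesic:
  assumes geo: "half_geodesic P v L"
  shows "\<exists>c. \<forall>t\<ge>0. \<exists>p\<in>square_points P. L t = surface_point P p \<and>
    level m k p - (c + t * (of_int m * fst v + of_int k * snd v)) \<in> \<int>"
proof -
  define w where "w = of_int m * fst v + of_int k * snd v"
  have after: "\<exists>b>t. straight_on P v L {t..b}" if "0 \<le> t" for t
    using geo that unfolding half_geodesic_def by blast
  have before: "\<exists>a\<ge>0. a < t \<and> straight_on P v L {a..t}" if "0 < t" for t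
    using geo that unfolding half_geodesic_def by blast
  have straight: "\<exists>c. \<forall>t\<in>I. \<exists>p\<in>square_points P. L t = surface_point P p \<and> level m k p = c + t * w"
    if st: "straight_on P v L I" for I
  proof -
    obtain s z where s: "s \<in> squares P" and z: "\<And>t. t \<in> I \<Longrightarrow> z + t *\<^sub>R v \<in> atomic s"
      "\<And>t. t \<in> I \<Longrightarrow> L t = surface_point P (s, z + t *\<^sub>R v)"
      using st unfolding straight_on_def by blast
    show ?thesis
    proof (intro exI[of _ "level m k (s, z)"] ballI)
      fix t assume t: "t \<in> I"
      show "\<exists>p\<in>square_points P. L t = surface_point P p \<and> level m k p = level m k (s, z) + t * w"
        using z[OF t] s unfolding w_def
        by (intro bexI[of _ "(s, z + t *\<^sub>R v)"] conjI level_line) (simp_all add: square_points_def)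
    qed
  qed
  obtain b0 where b0: "0 < b0" "straight_on P v L {0..b0}" using after[of 0] by auto
  obtain c where c: "\<And>t. t \<in> {0..b0} \<Longrightarrow> \<exists>p\<in>square_points P. L t = surface_point P p \<and> level m k p = c + t * w"
    using straight[OF b0(2)] by blast
  define Q where "Q t \<longleftrightarrow> (\<exists>p\<in>square_points P. L t = surface_point P p \<and> level m k p - (c + t * w) \<in> \<int>)" for t
  have Q_eq: "Q t'" if Qt: "Q t" and st: "straight_on P v L I" "t \<in> I" "t' \<in> I" for t t' I
  proof -
    obtain d where d: "\<And>t. t \<in> I \<Longrightarrow> \<exists>p\<in>square_points P. L t = surface_point P p \<and> level m k p = d + t * w"
      using straight[OF st(1)] by blast
    obtain p where p: "p \<in> square_points P" "L t = surface_point P p" "level m k p - (c + t * w) \<in> \<int>"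
      using Qt unfolding Q_def by blast
    obtain q where q: "q \<in> square_points P" "L t = surface_point P q" "level m k q = d + t * w"
      using d[OF st(2)] by blast
    obtain r where r: "r \<in> square_points P" "L t' = surface_point P r" "level m k r = d + t' * w"
      using d[OF st(3)] by blast
    have "(q, p) \<in> glue P"
      using surface_point_eq_iff[OF q(1) p(1)] p(2) q(2) by simp
    then have "(level m k q - level m k p) + (level m k p - (c + t * w)) \<in> \<int>"
      using level_glue p(3) by (intro Ints_add)
    then have "level m k r - (c + t' * w) \<in> \<int>"
      using q(3) r(3) by simp
    then show ?thesis unfolding Q_def using r by blast
  qed
  have "Q t" if "0 \<le> t" for t
    using that
  proof (induction rule: real_induction)
    case base
    have "0 \<in> {0..b0}" using b0(1) by simp
    from c[OF this] show ?case unfolding Q_def by force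
  next
    case (right x)
    obtain b where b: "x < b" "straight_on P v L {x..b}" using after[OF right(1)] by blast
    have "Q y" if "x \<le> y" "y \<le> b" for y
      by (rule Q_eq[OF right(3) b(2)]) (use that b(1) in auto)
    then show ?case using b(1) by blast
  next
    case (left x)
    obtain a where a: "0 \<le> a" "a < x" "straight_on P v L {a..x}" using before[OF left(1)] by blast
    show ?case
      by (rule Q_eq[OF left(3)[OF a(1,2)] a(3)]) (use a(2) in auto)
  qed
  then show ?thesis unfolding Q_def w_def by blast
qed

lemma level_surjective:
  fixes c :: real
  assumes "(m, k) \<noteq> (0, 0 :: int)"
  shows "\<exists>x y. 0 \<le> x \<and> x \<le> 1 \<and> 0 \<le> y \<and> y \<le> 1 \<and> of_int m * x + of_int k * y - c \<in> \<int>"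
proof -
  have one: "\<exists>x. 0 \<le> x \<and> x \<le> 1 \<and> of_int m * x - c \<in> \<int>" if "m \<noteq> 0" for m :: int
  proof -
    \<comment> \<open>The sign makes the coefficient positive; then the fractional part of
      \<open>\<sigma> * c\<close> divided by |m| lies in the unit interval and solves the
      congruence.\<close>
    define \<sigma> where "\<sigma> = real_of_int (sgn m)"
    have \<sigma>: "\<sigma> * \<sigma> = 1" "of_int m = \<sigma> * \<bar>of_int m\<bar>" "1 \<le> \<bar>real_of_int m\<bar>" "\<sigma> \<in> \<int>"
      using that unfolding \<sigma>_def by (auto simp: sgn_if)
    define x where "x = frac (\<sigma> * c) / \<bar>of_int m\<bar>"
    have "of_int m * x = \<sigma> * frac (\<sigma> * c)"
    proof -
      have "of_int m / \<bar>real_of_int m\<bar> = \<sigma>"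
        using \<sigma>(3) by (subst \<sigma>(2)) simp
      then show ?thesis unfolding x_def by (metis times_divide_eq_left times_divide_eq_right)
    qed
    also have "\<dots> = c - \<sigma> * of_int \<lfloor>\<sigma> * c\<rfloor>"
      unfolding frac_def using \<sigma>(1) by (simp add: algebra_simps)
    finally have "of_int m * x - c = - (\<sigma> * of_int \<lfloor>\<sigma> * c\<rfloor>)" by simp
    then have "of_int m * x - c \<in> \<int>"
      using \<sigma>(4) by simp
    moreover have "0 \<le> x" "x \<le> 1"
      using \<sigma>(3) frac_ge_0[of "\<sigma> * c"] frac_lt_1[of "\<sigma> * c"] unfolding x_def
      by (auto simp: divide_le_eq_1)
    ultimately show ?thesis by blast
  qed
  show ?thesis
  proof (cases "m = 0")
    case True
    then obtain y where "0 \<le> y" "y \<le> 1" "of_int k * y - c \<in> \<int>" using one[of k] assms by auto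
    then show ?thesis by (intro exI[of _ 0] exI[of _ y]) simp
  next
    case False
    then obtain x where "0 \<le> x" "x \<le> 1" "of_int m * x - c \<in> \<int>" using one[of m] by auto
    then show ?thesis by (intro exI[of _ x] exI[of _ 0]) simp
  qed
qed

text \<open>If \<open>m x + k y\<close> varies slowly along the geodesic, then modulo 1 it stays far away from some value
  during the time in which the geodesic ought to come close to every point.\<close>

lemma superdense_imp_bad:
  assumes geo: "half_geodesic P v L" and "superdense P L"
  shows "\<exists>c>0. \<forall>m k :: int. (m, k) \<noteq> (0, 0) \<longrightarrow>
    c \<le> \<bar>of_int m * fst v + of_int k * snd v\<bar> * (\<bar>of_int m\<bar> + \<bar>of_int k\<bar>)"
proof -
  obtain C where "C > 0" and C: "\<And>n X. \<lbrakk>1 \<le> n; X \<in> surface_points P\<rbrakk> \<Longrightarrow>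
      \<exists>t. 0 \<le> t \<and> t \<le> C * real n \<and> flat_dist P (L t) X \<le> 1 / real n"
    using assms(2) unfolding superdense_def by blast
  \<comment> \<open>With M = |m| + |k| and n = 5 M, a distance 1 / n changes the level by less than
    1/4 modulo 1, and a product below 1 / (20 C) lets it drift by less than 1/4 in time C n.\<close>
  have "1 / (20 * C) \<le> \<bar>of_int m * fst v + of_int k * snd v\<bar> * (\<bar>of_int m\<bar> + \<bar>of_int k\<bar>)"
    if mk: "(m, k) \<noteq> (0, 0)" for m k :: int
  proof (rule ccontr)
    define w where "w = of_int m * fst v + of_int k * snd v"
    define M where "M = \<bar>real_of_int m\<bar> + \<bar>real_of_int k\<bar>"
    define n where "n = 5 * nat (\<bar>m\<bar> + \<bar>k\<bar>)"
    assume "\<not> ?thesis"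
    then have small: "\<bar>w\<bar> * M < 1 / (20 * C)" unfolding w_def M_def by simp
    have n: "real n = 5 * M" unfolding n_def M_def by simp
    have "1 \<le> \<bar>m\<bar> + \<bar>k\<bar>" using mk by auto
    then have "1 \<le> real_of_int (\<bar>m\<bar> + \<bar>k\<bar>)" by linarith
    then have M: "1 \<le> M" unfolding M_def by simp
    obtain c where c: "\<And>t. 0 \<le> t \<Longrightarrow> \<exists>p\<in>square_points P. L t = surface_point P p \<and> level m k p - (c + t * w) \<in> \<int>"
      using level_along_geodesic[OF geo, of m k] unfolding w_def by blast
    \<comment> \<open>The target has a level at distance 1/2 modulo 1 from the initial one, beyond
      the reach of the two errors below 1/4.\<close>
    obtain x y where xy: "0 \<le> x" "x \<le> 1" "0 \<le> y" "y \<le> 1" "of_int m * x + of_int k * y - (c + 1 / 2) \<in> \<int>"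
      using level_surjective[OF mk] by blast
    obtain s where s: "s \<in> squares P" using squares_nonempty by blast
    define q where "q = loc s x y"
    have q: "q \<in> square_points P" "level m k q - (c + 1 / 2) \<in> \<int>"
      using s xy unfolding q_def by (simp_all add: square_points_iff level_loc)
    have "surface_point P q \<in> surface_points P"
      unfolding surface_points_def surface_point_def using q(1) by (rule quotientI)
    moreover have "1 \<le> n" using n M by linarith
    ultimately obtain t where t: "0 \<le> t" "t \<le> C * real n" "flat_dist P (L t) (surface_point P q) \<le> 1 / real n"
      using C by blast
    obtain p where p: "p \<in> square_points P" "L t = surface_point P p" "level m k p - (c + t * w) \<in> \<int>"
      using c[OF t(1)] by blast
    have "1 / real n < 1 / (4 * M)"
      unfolding n using M by (simp add: field_simps)
    then have "flat_dist P (surface_point P p) (surface_point P q) < 1 / (4 * M)"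
      using t(3) p(2) by simp
    from level_flat_dist[OF p(1) q(1) this mk]
    obtain j where j: "j \<in> \<int>" "\<bar>level m k p - level m k q - j\<bar> < 1 / 4"
      unfolding M_def[symmetric] using M by auto
    define i where "i = j - (level m k p - (c + t * w)) + (level m k q - (c + 1 / 2))"
    have "i \<in> \<int>" unfolding i_def using j(1) p(3) q(2) by (rule Ints_add[OF Ints_diff])
    have "\<bar>t * w - 1 / 2 - i\<bar> < 1 / 4"
      using j(2) unfolding i_def by (simp add: algebra_simps)
    moreover have "\<bar>t * w\<bar> < 1 / 4"
    proof -
      have "\<bar>t * w\<bar> \<le> C * real n * \<bar>w\<bar>"
        unfolding abs_mult using t by (intro mult_right_mono) auto
      also have "\<dots> = 5 * C * (\<bar>w\<bar> * M)" unfolding n by simp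
      also have "\<dots> < 5 * C * (1 / (20 * C))"
        using small \<open>C > 0\<close> by (intro mult_strict_left_mono) auto
      also have "\<dots> = 1 / 4" using \<open>C > 0\<close> by simp
      finally show ?thesis .
    qed
    moreover obtain z where "i = of_int z" using \<open>i \<in> \<int>\<close> by (rule Ints_cases)
    ultimately have "0 < real_of_int (z + 1)" "real_of_int z < 0" by (linarith | simp)+
    then have "0 < z + 1" "z < 0" by (simp_all only: of_int_0_less_iff of_int_less_0_iff)
    then show False by simp
  qed
  then show ?thesis using \<open>C > 0\<close> by (intro exI[of _ "1 / (20 * C)"]) simp
qed

end

theorem theorem1:
  fixes P :: surface and v :: "real \<times> real" and L :: "real \<Rightarrow> point set"
  assumes "polysquare_surface P"
    and "half_geodesic P v L"
    and "\<forall>t\<ge>0. L t \<notin> vertices P"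
  shows "superdense P L \<longleftrightarrow> fst v \<noteq> 0 \<and> badly_approximable (snd v / fst v)"
proof
  interpret flat_surface P by standard (rule assms(1))
  assume "superdense P L"
  then obtain c where "c > 0" and c: "\<And>m k :: int. (m, k) \<noteq> (0, 0) \<Longrightarrow>
    c \<le> \<bar>of_int m * fst v + of_int k * snd v\<bar> * (\<bar>of_int m\<bar> + \<bar>of_int k\<bar>)"
    using superdense_imp_bad[OF assms(2)] by blast
  \<comment> \<open>The level for (1, 0) would be constant along a vertical geodesic.\<close>
  have "fst v \<noteq> 0" using c[of 1 0] \<open>c > 0\<close> by auto
  moreover have "bad_form (snd v / fst v)"
    unfolding bad_form_def
  proof (intro exI[of _ "c / \<bar>fst v\<bar>"] conjI allI impI)
    fix m k :: int assume "(m, k) \<noteq> (0, 0)"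
    then have "c \<le> \<bar>of_int m * snd v - of_int k * fst v\<bar> * (\<bar>of_int m\<bar> + \<bar>of_int k\<bar>)"
      using c[of "- k" m] by (auto simp: add.commute)
    moreover have "\<bar>of_int m * snd v - of_int k * fst v\<bar> = \<bar>fst v\<bar> * \<bar>of_int m * (snd v / fst v) - of_int k\<bar>"
    proof -
      have "of_int m * snd v - of_int k * fst v = fst v * (of_int m * (snd v / fst v) - of_int k)"
        using \<open>fst v \<noteq> 0\<close> by (simp add: field_simps)
      then show ?thesis by (simp only: abs_mult)
    qed
    ultimately show "c / \<bar>fst v\<bar> \<le> \<bar>of_int m * (snd v / fst v) - of_int k\<bar> * (\<bar>of_int m\<bar> + \<bar>of_int k\<bar>)"
      using \<open>fst v \<noteq> 0\<close> by (simp add: divide_le_eq mult.assoc mult.commute mult.left_commute)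
  qed (use \<open>c > 0\<close> \<open>fst v \<noteq> 0\<close> in simp)
  ultimately show "fst v \<noteq> 0 \<and> badly_approximable (snd v / fst v)"
    using badly_approximable_iff_bad_form by blast
next
  assume v: "fst v \<noteq> 0 \<and> badly_approximable (snd v / fst v)"
  define \<alpha> where "\<alpha> = snd v / fst v"
  have bad: "bad_form \<alpha>" using v badly_approximable_iff_bad_form unfolding \<alpha>_def by blast
  have "\<alpha> \<noteq> 0" using bad_form_irrational[OF bad] by auto
  then have "snd v \<noteq> 0" unfolding \<alpha>_def by auto
  interpret oriented_path P v L
    using assms v \<open>snd v \<noteq> 0\<close> by unfold_locales auto
  obtain c where "c > 0" and c: "\<And>m k :: int. (m, k) \<noteq> (0, 0) \<Longrightarrow>
     c \<le> \<bar>real_of_int m * \<alpha> - real_of_int k\<bar> * (\<bar>real_of_int m\<bar> + \<bar>real_of_int k\<bar>)"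
    using bad unfolding bad_form_def by blast
  show "superdense P L"
  proof (rule superdense_if_bad)
    show "0 < A * c" using \<open>c > 0\<close> AB_pos by simp
    fix i j :: nat assume ij: "(i, j) \<noteq> (0, 0)"
    \<comment> \<open>After the reflections only i A - j B with i, j >= 0 occurs; the sign of
      \<open>k\<close> undoes the reflection when \<alpha> is negative.\<close>
    define k where "k = (if 0 < \<alpha> then int i else - int i)"
    have k: "\<bar>real_of_int k\<bar> = real i" unfolding k_def by simp
    have "\<bar>real j * \<alpha> - real_of_int k\<bar> = \<bar>real j * \<bar>\<alpha>\<bar> - real i\<bar>"
    proof (cases "0 < \<alpha>")
      case False
      then have "real j * \<bar>\<alpha>\<bar> - real i = - (real j * \<alpha> - real_of_int k)"
        unfolding k_def by simp
      then show ?thesis by (simp only: abs_minus_cancel)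
    qed (simp add: k_def)
    moreover have "A * \<bar>real j * \<bar>\<alpha>\<bar> - real i\<bar> = \<bar>real i * A - real j * B\<bar>"
    proof -
      have "A * \<bar>\<alpha>\<bar> = B" using v unfolding \<alpha>_def by simp
      then have "A * (real j * \<bar>\<alpha>\<bar> - real i) = real j * B - real i * A"
        by (simp add: algebra_simps)
      then have "A * \<bar>real j * \<bar>\<alpha>\<bar> - real i\<bar> = \<bar>real j * B - real i * A\<bar>"
        by (metis abs_abs abs_mult)
      then show ?thesis by (simp add: abs_minus_commute)
    qed
    ultimately have "A * \<bar>real j * \<alpha> - real_of_int k\<bar> = \<bar>real i * A - real j * B\<bar>" by simp
    moreover have "c \<le> \<bar>real j * \<alpha> - real_of_int k\<bar> * real (i + j)"
      using c[of "int j" k] ij k by (auto simp: k_def add.commute split: if_splits)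
    then have "A * c \<le> A * (\<bar>real j * \<alpha> - real_of_int k\<bar> * real (i + j))"
      using AB_pos by (intro mult_left_mono) auto
    ultimately show "A * c \<le> \<bar>real i * A - real j * B\<bar> * real (i + j)"
      by (simp add: mult.assoc[symmetric])
  qed
qed

end
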